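(* Let $\gamma>0$. Consider the moment system closed with the ansatz $f^\gamma_{\mathbf u}=\exp(\nabla_{\mathbf u}h^\gamma(\mathbf u)\cdot\mathbf m)$, $$\partial_t\mathbf u+\nabla_{\mathbf x}\cdot\langle\mathbf v\otimes\mathbf m f^\gamma_{\mathbf u}\rangle=\langle\mathbf m\,Q(f^\gamma_{\mathbf u})\rangle, \qquad ( * )$$ for $\mathbf u=\mathbf u(t,\mathbf x)$ with values in $\{\mathbf u\in\mathbb R^{n+1}:u_0>0\}$. Then the partially regularized entropy function $h^\gamma$ is an entropy for $( * )$, with associated entropy flux $$\mathbf j^\gamma(\mathbf u)=\langle\mathbf v\,\eta(f^\gamma_{\mathbf u})\rangle .$$ With $h^\gamma$ and $\mathbf j^\gamma$, the entropy dissipation law $$\partial_t h^\gamma(\mathbf u)+\nabla_{\mathbf x}\cdot\mathbf j^\gamma(\mathbf u)\le0$$ holds (for classical solutions $\mathbf u$ of $( * )$). Furthermore, the closed moment system $( * )$ is symmetrizable hyperbolic.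
   Context: Write $\langle g\rangle=\int_{\mathbb S^2}g(\mathbf v)\,d\mathbf v$, where $\mathbb S^2$ is the unit sphere in $\mathbb R^3$; $\|\cdot\|$ is the Euclidean norm. Let $N\ge1$ and let $\mathbf m=[m_0,\mathbf m_\#^\top]^\top:\mathbb S^2\to\mathbb R^{n+1}$, $n+1=(N+1)^2$, be the vector of real spherical harmonics up to degree $N$, ordered by degree; $m_0$ is a positive constant and $\mathbf m_\#$ collects the remaining $n$ entries. For $\mathbf y=(y_0,\dots,y_n)^\top$ set $\mathbf y_\#=(y_1,\dots,y_n)^\top$. The kinetic entropy density is $\eta(z)=z\log z-z$ on $[0,\infty)$, with $\eta'(z)=\log z$ and Legendre dual $\eta_*=\exp$. The collision operator is $Q(f)(\mathbf v)=\int_{\mathbb S^2}\sigma_{\mathrm s}(\mathbf x)\,[f(\mathbf v_* )-f(\mathbf v)]\,d\mathbf v_*$ with $\sigma_{\mathrm s}(\mathbf x)\ge0$; it satisfies $\langle\eta'(f)Q(f)\rangle\le0$. For $u_0>0$, $\gamma>0$, let $$\phi^\gamma(\boldsymbol\alpha;\mathbf u)=\langle\exp(\boldsymbol\alpha\cdot\mathbf m)\rangle-\boldsymbol\alpha\cdot\mathbf u+\frac{u_0\gamma}{2}\|\boldsymbol\alpha_\#\|^2,\qquad\boldsymbol\alpha\in\mathbb R^{n+1},$$ with minimizer $\boldsymbol\alpha^\gamma_{\mathbf u}$. The partially regularized entropy $h^\gamma(\mathbf u)$ is the optimal value of $\min_{g\ge0}\langle\eta(g)\rangle+\frac{1}{2u_0\gamma}\|\langle\mathbf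 m_\# g\rangle-\mathbf u_\#\|^2$ subject to $u_0=\langle m_0g\rangle$ (over nonnegative $g$ on $\mathbb S^2$ with finite moments $\langle \mathbf m g\rangle$); by (known) strong duality $h^\gamma(\mathbf u)=-\phi^\gamma(\boldsymbol\alpha^\gamma_{\mathbf u};\mathbf u)$. Terminology. Write $F_i(\mathbf u)=\langle v_i\,\mathbf m f^\gamma_{\mathbf u}\rangle$, $i=1,2,3$, so that $\nabla_{\mathbf x}\cdot\langle\mathbf v\otimes\mathbf m f^\gamma_{\mathbf u}\rangle=\sum_i\partial_{x_i}F_i(\mathbf u)$. A convex function $h$ is an entropy for $( * )$ with entropy flux $\mathbf j=(j_1,j_2,j_3)$ if $\nabla_{\mathbf u}j_i(\mathbf u)=(\nabla_{\mathbf u}F_i(\mathbf u))^\top\nabla_{\mathbf u}h(\mathbf u)$ for $i=1,2,3$ (with $\nabla_{\mathbf u}F_i$ the Jacobian matrix) and $\nabla_{\mathbf u}h(\mathbf u)\cdot\langle\mathbf m Q(f^\gamma_{\mathbf u})\rangle\le0$. The system $( * )$ is symmetrizable hyperbolic if there is a symmetric positive definite matrix $K(\mathbf u)$ such that $K(\mathbf u)\nabla_{\mathbf u}F_i(\mathbf u)$ is symmetric for each $i=1,2,3$. *)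

theory Defs
  imports
    "HOL-Analysis.Analysis"
    "HOL-Computational_Algebra.Polynomial"
    "HOL-Library.Discrete_Functions"
begin

text \<open>Angular integration: the surface measure on the unit sphere, obtained by transporting
  \<open>sin \<theta> d\<theta> d\<phi>\<close> along spherical coordinates. The underlying space of the measure is the
  sphere itself, so measurability and integrability only concern values on the sphere.\<close>

abbreviation unit_sphere :: "(real^3) set"
  where "unit_sphere \<equiv> sphere 0 1"

definition sphere_measure :: "(real^3) measure"
  where "sphere_measure =
    distr
      (density lborel (\<lambda>(\<theta>, \<phi>).
         ennreal (indicator ({0..pi} \<times> {0..2 * pi}) (\<theta>, \<phi>) * sin \<theta>)))
      (restrict_space borel unit_sphere)
      (\<lambda>(\<theta>, \<phi>). vector [sin \<theta> * cos \<phi>, sin \<theta> * sin \<phi>, cos \<theta>])"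

abbreviation mean :: "(real^3 \<Rightarrow> 'b::{banach, second_countable_topology}) \<Rightarrow> 'b"
  where "mean g \<equiv> integral\<^sup>L sphere_measure g"


text \<open>Real spherical harmonics, orthonormal in \<open>L\<^sup>2\<close> of the sphere and without the
  Condon-Shortley phase. They are written in Cartesian form: on the sphere
  \<open>(v\<^sub>1 + \<i> v\<^sub>2)\<^sup>a = (sin \<theta>)\<^sup>a e\<^sup>i\<^sup>a\<^sup>\<phi>\<close>, so the product with the \<open>a\<close>-th derivative of the
  Legendre polynomial at \<open>v\<^sub>3 = cos \<theta>\<close> is the associated Legendre function times
  \<open>cos (a \<phi>)\<close> or \<open>sin (a \<phi>)\<close>.\<close>

definition legendre_poly :: "nat \<Rightarrow> real poly"
  where "legendre_poly l = smult (1 / (2 ^ l * fact l)) ((pderiv ^^ l) ([:-1, 0, 1:] ^ l))"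

definition real_sph_harm :: "nat \<Rightarrow> int \<Rightarrow> real^3 \<Rightarrow> real"
  where "real_sph_harm l k v =
    (let a = nat \<bar>k\<bar>;
         c = sqrt ((2 * real l + 1) / (4 * pi) * (fact (l - a) / fact (l + a)));
         p = poly ((pderiv ^^ a) (legendre_poly l)) (v$3);
         w = Complex (v$1) (v$2) ^ a
     in if k = 0 then c * p
        else if k > 0 then sqrt 2 * c * p * Re w
        else sqrt 2 * c * p * Im w)"

text \<open>Enumeration by degree: the positions \<open>l\<^sup>2, \<dots>, l\<^sup>2 + 2 l\<close> carry degree \<open>l\<close> with the
  orders \<open>-l, \<dots>, l\<close>.\<close>

definition sph_harm_nth :: "nat \<Rightarrow> real^3 \<Rightarrow> real"
  where "sph_harm_nth j =
    (let l = floor_sqrt j in real_sph_harm l (int j - int (l\<^sup>2) - int l))"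


text \<open>Moment vectors are indexed by a finite linearly ordered type; the \<open>j\<close>-th entry (counting
  from \<open>0\<close>) belongs to the index that has exactly \<open>j\<close> smaller ones. All harmonics up to degree
  \<open>N\<close> occur, each once, precisely when the index type has \<open>(N + 1)\<^sup>2\<close> elements.\<close>

definition idx0 :: "'n::{finite, linorder}"
  where "idx0 = Min UNIV"

definition position :: "'n::{finite, linorder} \<Rightarrow> nat"
  where "position i = card {..<i}"

definition moments :: "real^3 \<Rightarrow> real^'n::{finite, linorder}"
  where "moments v = (\<chi> i. sph_harm_nth (position i) v)"

text \<open>The vector of all entries but the zeroth is represented by setting that entry to \<open>0\<close>, which
  leaves inner products and norms unchanged.\<close>

definition sharp :: "real^'n::{finite, linorder} \<Rightarrow> real^'n::{finite, linorder}"
  where "sharp y = (\<chi> i. if i = idx0 then 0 else y$i)"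

definition states :: "(real^'n::{finite, linorder}) set"
  where "states = {u. u$idx0 > 0}"


text \<open>At \<open>z = 0\<close> the conventional value \<open>0 log 0 = 0\<close> is the one delivered by \<open>ln 0 = 0\<close>.\<close>

definition \<eta> :: "real \<Rightarrow> real"
  where "\<eta> z = z * ln z - z"

text \<open>As \<open>\<eta> \<ge> -1\<close> and the sphere has finite measure, the mean of \<open>\<eta> \<circ> g\<close> is \<open>+\<infinity>\<close> when \<open>\<eta> \<circ> g\<close>
  is not integrable. Such \<open>g\<close> do not influence the optimal value; they are excluded because the
  Bochner integral would assign them \<open>0\<close>.\<close>

definition admissible :: "real^'n::{finite, linorder} \<Rightarrow> (real^3 \<Rightarrow> real) set"
  where "admissible u =
    {g. g \<in> borel_measurable sphere_measure \<and>
        (\<forall>v\<in>unit_sphere. 0 \<le> g v) \<and>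
        integrable sphere_measure (\<lambda>v. g v *\<^sub>R (moments v :: real^'n::{finite, linorder})) \<and>
        integrable sphere_measure (\<lambda>v. \<eta> (g v)) \<and>
        mean (\<lambda>v. moments v $ (idx0 :: 'n) * g v) = u$idx0}"

definition objective :: "real \<Rightarrow> real^'n::{finite, linorder} \<Rightarrow> (real^3 \<Rightarrow> real) \<Rightarrow> real"
  where "objective \<gamma> u g =
    mean (\<lambda>v. \<eta> (g v)) +
    1 / (2 * u$idx0 * \<gamma>) * (norm (mean (\<lambda>v. g v *\<^sub>R sharp (moments v)) - sharp u))\<^sup>2"

definition reg_entropy :: "real \<Rightarrow> real^'n::{finite, linorder} \<Rightarrow> real"
  where "reg_entropy \<gamma> u = Inf (objective \<gamma> u ` admissible u)"


definition grad :: "(real^'n \<Rightarrow> real) \<Rightarrow> real^'n \<Rightarrow> real^'n"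
  where "grad h u = (\<chi> i. frechet_derivative h (at u) (axis i 1))"

definition ansatz :: "real \<Rightarrow> real^'n::{finite, linorder} \<Rightarrow> real^3 \<Rightarrow> real"
  where "ansatz \<gamma> u v = exp (grad (reg_entropy \<gamma>) u \<bullet> moments v)"

text \<open>The scattering rate \<open>s\<close> is the value of \<open>\<sigma>\<^sub>s\<close> at the spatial point under consideration.\<close>

definition collision :: "real \<Rightarrow> (real^3 \<Rightarrow> real) \<Rightarrow> real^3 \<Rightarrow> real"
  where "collision s f v = mean (\<lambda>w. s * (f w - f v))"

definition moment_flux :: "real \<Rightarrow> 3 \<Rightarrow> real^'n::{finite, linorder} \<Rightarrow> real^'n::{finite, linorder}"
  where "moment_flux \<gamma> i u = mean (\<lambda>v. (v$i * ansatz \<gamma> u v) *\<^sub>R moments v)"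

definition moment_source ::
    "real \<Rightarrow> (real^3 \<Rightarrow> real) \<Rightarrow> real^3 \<Rightarrow> real^'n::{finite, linorder} \<Rightarrow> real^'n::{finite, linorder}"
  where "moment_source \<gamma> \<sigma> x u = mean (\<lambda>v. collision (\<sigma> x) (ansatz \<gamma> u) v *\<^sub>R moments v)"

definition entropy_flux :: "real \<Rightarrow> 3 \<Rightarrow> real^'n::{finite, linorder} \<Rightarrow> real"
  where "entropy_flux \<gamma> i u = mean (\<lambda>v. v$i * \<eta> (ansatz \<gamma> u v))"


text \<open>Balance laws \<open>\<partial>\<^sub>t u + \<Sum>\<^sub>i \<partial>\<^sub>x\<^sub>i F\<^sub>i(u) = S(x, u)\<close> with values of \<open>u\<close> in an open set \<open>U\<close>.\<close>

definition entropy_pair ::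
    "(real^'n) set \<Rightarrow> (3 \<Rightarrow> real^'n \<Rightarrow> real^'n) \<Rightarrow> (real^3 \<Rightarrow> real^'n \<Rightarrow> real^'n) \<Rightarrow>
     (real^'n \<Rightarrow> real) \<Rightarrow> (3 \<Rightarrow> real^'n \<Rightarrow> real) \<Rightarrow> bool"
  where "entropy_pair U F S h j \<longleftrightarrow>
    convex_on U h \<and>
    (\<forall>u\<in>U. h differentiable (at u) \<and>
      (\<forall>i. F i differentiable (at u) \<and> j i differentiable (at u) \<and>
           grad (j i) u = transpose (jacobian (F i) (at u)) *v grad h u) \<and>
      (\<forall>x. grad h u \<bullet> S x u \<le> 0))"

definition symmetrizable_hyperbolic ::
    "(real^'n) set \<Rightarrow> (3 \<Rightarrow> real^'n \<Rightarrow> real^'n) \<Rightarrow> bool"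
  where "symmetrizable_hyperbolic U F \<longleftrightarrow>
    (\<forall>u\<in>U. \<forall>i. F i differentiable (at u)) \<and>
    (\<exists>K :: real^'n \<Rightarrow> real^'n^'n. \<forall>u\<in>U.
       transpose (K u) = K u \<and>
       (\<forall>w. w \<noteq> 0 \<longrightarrow> w \<bullet> (K u *v w) > 0) \<and>
       (\<forall>i. transpose (K u ** jacobian (F i) (at u)) = K u ** jacobian (F i) (at u)))"

definition dt :: "(real \<times> (real^3) \<Rightarrow> 'b::real_normed_vector) \<Rightarrow> real \<times> (real^3) \<Rightarrow> 'b"
  where "dt w = (\<lambda>(t, x). vector_derivative (\<lambda>s. w (s, x)) (at t))"

definition dx :: "3 \<Rightarrow> (real \<times> (real^3) \<Rightarrow> 'b::real_normed_vector) \<Rightarrow> real \<times> (real^3) \<Rightarrow> 'b"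
  where "dx i w = (\<lambda>(t, x). vector_derivative (\<lambda>s. w (t, x + s *\<^sub>R axis i 1)) (at 0))"

definition continuously_differentiable_on ::
    "('a::real_normed_vector) set \<Rightarrow> ('a \<Rightarrow> 'b::real_normed_vector) \<Rightarrow> bool"
  where "continuously_differentiable_on D w \<longleftrightarrow>
    (\<exists>w' :: 'a \<Rightarrow> 'a \<Rightarrow>\<^sub>L 'b.
       (\<forall>p\<in>D. (w has_derivative blinfun_apply (w' p)) (at p)) \<and> continuous_on D w')"

definition classical_solution ::
    "(real^'n) set \<Rightarrow> (3 \<Rightarrow> real^'n \<Rightarrow> real^'n) \<Rightarrow> (real^3 \<Rightarrow> real^'n \<Rightarrow> real^'n) \<Rightarrow>
     (real \<times> (real^3)) set \<Rightarrow> (real \<times> (real^3) \<Rightarrow> real^'n) \<Rightarrow> bool"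
  where "classical_solution U F S D u \<longleftrightarrow>
    open D \<and> continuously_differentiable_on D u \<and>
    (\<forall>p\<in>D. u p \<in> U \<and>
      dt u p + (\<Sum>i\<in>UNIV. dx i (\<lambda>q. F i (u q)) p) = S (snd p) (u p))"

text \<open>The differentiability clause keeps the derivatives in the inequality meaningful.\<close>

definition entropy_dissipation ::
    "(real^'n \<Rightarrow> real) \<Rightarrow> (3 \<Rightarrow> real^'n \<Rightarrow> real) \<Rightarrow>
     (real \<times> (real^3)) set \<Rightarrow> (real \<times> (real^3) \<Rightarrow> real^'n) \<Rightarrow> bool"
  where "entropy_dissipation h j D u \<longleftrightarrow>
    (\<forall>p\<in>D.
      (\<lambda>q. h (u q)) differentiable (at p) \<and>
      (\<forall>i. (\<lambda>q. j i (u q)) differentiable (at p)) \<and>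
      dt (\<lambda>q. h (u q)) p + (\<Sum>i\<in>UNIV. dx i (\<lambda>q. j i (u q)) p) \<le> 0)"

end

theory Submission
  imports Defs
begin

text \<open>
  The result rests on one observation: on the states, the regularized entropy \<open>h\<close> is the Legendre
  transform of the smooth function
  \<open>P(\<beta>) = \<langle>exp (\<beta> \<bullet> m + m\<^sub>0 \<gamma> / 2 * \<parallel>\<beta>\<^sub>#\<parallel>\<^sup>2)\<rangle>\<close>,
  whose Hessian is symmetric and positive definite. To see where \<open>P\<close> comes from, take the dual
  objective \<open>\<langle>exp (\<alpha> \<bullet> m)\<rangle> - \<alpha> \<bullet> u + u\<^sub>0 \<gamma> / 2 * \<parallel>\<alpha>\<^sub>#\<parallel>\<^sup>2\<close>, whose quadratic term carries the
  state-dependent weight \<open>u\<^sub>0\<close>. Substituting \<open>\<alpha> = \<beta> + \<gamma> / 2 * \<parallel>\<beta>\<^sub>#\<parallel>\<^sup>2 e\<^sub>0\<close> (so that \<open>\<alpha>\<^sub># = \<beta>\<^sub>#\<close>)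
  cancels this term against \<open>\<alpha>\<^sub>0 u\<^sub>0\<close>, and because \<open>m\<^sub>0\<close> is constant the objective becomes
  \<open>P(\<beta>) - \<beta> \<bullet> u\<close>, in which \<open>u\<close> occurs only linearly.

  The gradient of \<open>P\<close> is a bijection onto the states: it is injective because the Hessian is
  positive definite, and for \<open>u\<^sub>0 > 0\<close> the function \<open>P(\<beta>) - \<beta> \<bullet> u\<close> has bounded sublevel sets
  and hence a critical point (\<open>inj_potential_grad\<close>, \<open>potential_grad_surj_states\<close>). Its inverse
  \<open>\<beta>(u)\<close>, the entropy variable, is differentiable. Strong duality is verified by hand: the
  Fenchel-Young inequality bounds every competitor from below, and the density
  \<open>exp (\<beta>(u) \<bullet> m + m\<^sub>0 \<gamma> / 2 * \<parallel>\<beta>(u)\<^sub>#\<parallel>\<^sup>2)\<close> attains the bound (\<open>weak_duality\<close>,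
  \<open>exponential_density_optimal\<close>). Consequently \<open>h\<close> is a pointwise maximum of affine functions
  of \<open>u\<close>, so convex; its gradient is \<open>\<beta>(u)\<close>; and its Hessian is the inverse of that of \<open>P\<close>, so
  symmetric and positive definite.

  The rest is the classical mechanism of entropy variables. The ansatz is \<open>exp (\<beta>(u) \<bullet> m)\<close>, so
  the flux \<open>F\<^sub>i\<close> is a function of \<open>\<beta>(u)\<close> whose derivative in \<open>\<beta>\<close> is the symmetric matrix
  \<open>\<langle>v\<^sub>i m m\<^sup>T exp (\<beta> \<bullet> m)\<rangle>\<close>. With \<open>K = D\<^sup>2 h\<close> and this matrix called \<open>S\<^sub>i\<close>, the product
  \<open>K DF\<^sub>i = K S\<^sub>i K\<close> is symmetric. Differentiating \<open>\<eta> (exp y) = y exp y - exp y\<close> gives the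
  compatibility of the entropy flux, and the chain rule turns that compatibility into the
  dissipation law, the sign coming from the monotonicity of the exponential in the collision term.
\<close>

section \<open>Gradients, Jacobians and entropy dissipation\<close>

lemma grad_eqI:
  assumes "(h has_derivative (\<lambda>d. g \<bullet> d)) (at u)"
  shows "grad h u = g"
  using frechet_derivative_at[OF assms]
  by (simp add: grad_def vec_eq_iff inner_axis fun_eq_iff flip: frechet_derivative_at[OF assms])

lemma has_derivative_grad:
  assumes "h differentiable (at u)"
  shows "(h has_derivative (\<lambda>d. grad h u \<bullet> d)) (at u)"
proof -
  obtain D where D: "(h has_derivative D) (at u)"
    using assms unfolding differentiable_def by blast
  then have "linear D"
    by (rule has_derivative_linear)
  have "D d = (\<chi> i. D (axis i 1)) \<bullet> d" for d
  proof -
    have "D d = D (\<Sum>i\<in>UNIV. d $ i *\<^sub>R axis i 1)"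
      using basis_expansion[of d] by (simp add: scalar_mult_eq_scaleR)
    also have "\<dots> = (\<chi> i. D (axis i 1)) \<bullet> d"
      by (simp add: linear_sum[OF \<open>linear D\<close>] linear_cmul[OF \<open>linear D\<close>] inner_vec_def mult.commute)
    finally show ?thesis .
  qed
  then have "D = (\<lambda>d. (\<chi> i. D (axis i 1)) \<bullet> d)"
    by blast
  then show ?thesis
    using D grad_eqI by metis
qed

lemma jacobian_vector:
  fixes F :: "real^'n \<Rightarrow> real^'m"
  assumes "(F has_derivative D) (at u)"
  shows "jacobian F (at u) *v d = D d"
proof -
  have "(F has_derivative (\<lambda>d. jacobian F (at u) *v d)) (at u)"
    using differentiableI[OF assms] by (rule jacobian_works[THEN iffD1])
  from has_derivative_unique[OF this assms] show ?thesis
    by (rule fun_cong)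
qed

lemma inner_transpose_matrix_vector:
  fixes A :: "real^'n^'m"
  shows "(transpose A *v x) \<bullet> y = x \<bullet> (A *v y)"
  by (simp add: dot_lmul_matrix transpose_matrix_vector)

text \<open>A formulation by the bilinear form lets symmetry of matrix products be checked on the
  derivatives that the matrices represent.\<close>

lemma transpose_eq_self_iff:
  fixes A :: "real^'n^'n"
  shows "transpose A = A \<longleftrightarrow> (\<forall>x y. x \<bullet> (A *v y) = y \<bullet> (A *v x))"
proof
  assume "transpose A = A"
  then show "\<forall>x y. x \<bullet> (A *v y) = y \<bullet> (A *v x)"
    using inner_transpose_matrix_vector[of A] by (metis inner_commute)
next
  assume *: "\<forall>x y. x \<bullet> (A *v y) = y \<bullet> (A *v x)"
  have "transpose A *v x = A *v x" for x
  proof (rule vector_eq_rdot[THEN iffD1], rule allI)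
    show "(transpose A *v x) \<bullet> y = (A *v x) \<bullet> y" for y
      unfolding inner_transpose_matrix_vector using * by (simp add: inner_commute[of _ y])
  qed
  then show "transpose A = A"
    by (simp add: matrix_eq)
qed

lemma dt_eq:
  assumes "(w has_derivative w') (at p)"
  shows "dt w p = w' (1, 0)"
proof -
  obtain t x where p: "p = (t, x)" by fastforce
  have "((\<lambda>s. (s, x)) has_vector_derivative (1, 0)) (at t)"
    unfolding has_vector_derivative_def by (auto intro!: derivative_eq_intros)
  from vector_derivative_diff_chain_within[OF this, of w w'] assms
  have "((\<lambda>s. w (s, x)) has_vector_derivative w' (1, 0)) (at t)"
    by (simp add: p o_def has_derivative_at_withinI)
  then show ?thesis
    by (simp add: p dt_def vector_derivative_at)
qed

lemma dx_eq:
  assumes "(w has_derivative w') (at p)"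
  shows "dx i w p = w' (0, axis i 1)"
proof -
  obtain t x where p: "p = (t, x)" by fastforce
  have "((\<lambda>s. (t, x + s *\<^sub>R axis i 1)) has_vector_derivative (0, axis i 1)) (at 0)"
    unfolding has_vector_derivative_def by (auto intro!: derivative_eq_intros)
  from vector_derivative_diff_chain_within[OF this, of w w'] assms
  have "((\<lambda>s. w (t, x + s *\<^sub>R axis i 1)) has_vector_derivative w' (0, axis i 1)) (at 0)"
    by (simp add: p o_def has_derivative_at_withinI)
  then show ?thesis
    by (simp add: p dx_def vector_derivative_at)
qed

text \<open>By the chain rule and the compatibility of the fluxes, the left-hand side of the dissipation law
  is the inner product of \<open>grad h\<close> with the left-hand side of the balance law, that is, with the
  source, which has the right sign by definition of an entropy.\<close>

lemma entropy_pair_dissipation: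
  fixes u :: "real \<times> (real^3) \<Rightarrow> real^'n"
  assumes pair: "entropy_pair U F S h j" and sol: "classical_solution U F S D u"
  shows "entropy_dissipation h j D u"
  unfolding entropy_dissipation_def
proof (intro ballI)
  fix p assume p: "p \<in> D"
  let ?v = "u p"
  have v: "?v \<in> U" and pde: "dt u p + (\<Sum>i\<in>UNIV. dx i (\<lambda>q. F i (u q)) p) = S (snd p) ?v"
    using sol p by (auto simp: classical_solution_def)
  obtain u' where u': "(u has_derivative u') (at p)"
    using sol p unfolding classical_solution_def continuously_differentiable_on_def by blast
  have h: "h differentiable (at ?v)" and F: "F i differentiable (at ?v)"
    and j: "j i differentiable (at ?v)"
    and "grad (j i) ?v = transpose (jacobian (F i) (at ?v)) *v grad h ?v"
    and source: "grad h ?v \<bullet> S x ?v \<le> 0" for i x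
    using pair v by (auto simp: entropy_pair_def)
  then have grad_j: "grad (j i) ?v \<bullet> d = grad h ?v \<bullet> (jacobian (F i) (at ?v) *v d)" for i d
    by (simp only: inner_transpose_matrix_vector)
  have hu: "((\<lambda>q. h (u q)) has_derivative (\<lambda>d. grad h ?v \<bullet> u' d)) (at p)"
    by (rule has_derivative_compose[OF u' has_derivative_grad[OF h]])
  have ju: "((\<lambda>q. j i (u q)) has_derivative (\<lambda>d. grad (j i) ?v \<bullet> u' d)) (at p)" for i
    by (rule has_derivative_compose[OF u' has_derivative_grad[OF j]])
  have Fu: "((\<lambda>q. F i (u q)) has_derivative (\<lambda>d. jacobian (F i) (at ?v) *v u' d)) (at p)" for i
    using F jacobian_works by (intro has_derivative_compose[OF u']) blast
  have "dt (\<lambda>q. h (u q)) p + (\<Sum>i\<in>UNIV. dx i (\<lambda>q. j i (u q)) p)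
      = grad h ?v \<bullet> (dt u p + (\<Sum>i\<in>UNIV. dx i (\<lambda>q. F i (u q)) p))"
    by (simp add: dt_eq[OF hu] dx_eq[OF ju] dt_eq[OF u'] dx_eq[OF Fu] grad_j
        inner_add_right inner_sum_right)
  then have "dt (\<lambda>q. h (u q)) p + (\<Sum>i\<in>UNIV. dx i (\<lambda>q. j i (u q)) p) \<le> 0"
    using source by (simp add: pde)
  then show "(\<lambda>q. h (u q)) differentiable (at p) \<and> (\<forall>i. (\<lambda>q. j i (u q)) differentiable (at p)) \<and>
      dt (\<lambda>q. h (u q)) p + (\<Sum>i\<in>UNIV. dx i (\<lambda>q. j i (u q)) p) \<le> 0"
    using hu ju unfolding differentiable_def by blast
qed

section \<open>The surface measure\<close>

lemma measurable_spherical_coordinates: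
  "(\<lambda>(\<theta>, \<phi>). vector [sin \<theta> * cos \<phi>, sin \<theta> * sin \<phi>, cos \<theta>] :: real^3)
     \<in> borel_measurable (lborel :: (real \<times> real) measure)"
proof -
  have "continuous_on UNIV (\<lambda>(\<theta>, \<phi>). vector [sin \<theta> * cos \<phi>, sin \<theta> * sin \<phi>, cos \<theta>] :: real^3)"
    unfolding case_prod_beta continuous_on_componentwise[where 'b="real^3"]
    by (auto simp: Basis_vec_def inner_axis forall_3 intro!: continuous_intros)
  then show ?thesis
    by (simp add: borel_measurable_continuous_onI)
qed

lemma norm_spherical_coordinates [simp]:
  "norm (vector [sin \<theta> * cos \<phi>, sin \<theta> * sin \<phi>, cos \<theta>] :: real^3) = 1" for \<theta> \<phi> :: real
proof -
  have "(sin \<theta> * cos \<phi>)\<^sup>2 + (sin \<theta> * sin \<phi>)\<^sup>2 + (cos \<theta>)\<^sup>2 = 1"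
    by (simp add: power_mult_distrib flip: distrib_left)
  then show ?thesis
    by (simp add: norm_vec_def L2_set_def sum_3)
qed

lemma space_sphere_measure [simp]: "space sphere_measure = unit_sphere"
  by (simp add: sphere_measure_def space_restrict_space)

lemma sets_sphere_measure [measurable_cong]:
  "sets sphere_measure = sets (restrict_space borel unit_sphere)"
  by (simp add: sphere_measure_def)

lemma measurable_spherical_density:
  "(\<lambda>(\<theta>, \<phi>). ennreal (indicator ({0..pi} \<times> {0..2 * pi}) (\<theta>, \<phi>) * sin \<theta>))
     \<in> borel_measurable lborel"
proof -
  have "(\<lambda>x. ennreal (indicator (cbox (0, 0) (pi, 2 * pi)) x * sin (fst x))) \<in> borel_measurable borel"
    by (intro measurable_compose[OF _ measurable_ennreal] borel_measurable_times
        borel_measurable_indicator borel_measurable_continuous_onI continuous_intros) auto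
  then show ?thesis
    by (simp add: cbox_Pair_eq split_def)
qed

lemma emeasure_sphere_measure_space:
  "emeasure sphere_measure unit_sphere =
     (\<integral>\<^sup>+ (\<theta>, \<phi>). ennreal (indicator ({0..pi} \<times> {0..2 * pi}) (\<theta>, \<phi>) * sin \<theta>) \<partial>lborel)"
proof -
  let ?d = "\<lambda>(\<theta>, \<phi>). ennreal (indicator ({0..pi} \<times> {0..2 * pi}) (\<theta>, \<phi>) * sin \<theta>)"
  have T: "(\<lambda>(\<theta>, \<phi>). vector [sin \<theta> * cos \<phi>, sin \<theta> * sin \<phi>, cos \<theta>] :: real^3)
     \<in> density lborel ?d \<rightarrow>\<^sub>M restrict_space borel unit_sphere"
    using measurable_spherical_coordinates
    by (intro measurable_restrict_space2) (auto simp: split_def)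
  have "emeasure sphere_measure unit_sphere = emeasure (density lborel ?d) UNIV"
    unfolding sphere_measure_def
    using sets.top[of "restrict_space borel unit_sphere"]
    by (subst emeasure_distr[OF T])
      (simp_all add: space_restrict_space vimage_def split_def)
  also have "\<dots> = (\<integral>\<^sup>+ x. ?d x \<partial>lborel)"
    by (subst emeasure_density[OF measurable_spherical_density]) (simp_all add: split_def)
  finally show ?thesis .
qed

lemma finite_measure_sphere_measure: "finite_measure sphere_measure"
proof
  have "emeasure sphere_measure unit_sphere \<le>
      (\<integral>\<^sup>+ x. indicator (cbox (0,0) (pi, 2 * pi)) x \<partial>lborel)"
    unfolding emeasure_sphere_measure_space
    by (intro nn_integral_mono) (auto simp: indicator_def cbox_Pair_eq split: prod.splits)
  also have "\<dots> < \<infinity>"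
    by (simp add: emeasure_lborel_cbox_eq)
  finally show "emeasure sphere_measure (space sphere_measure) \<noteq> \<infinity>"
    by auto
qed

interpretation sphere_measure: finite_measure sphere_measure
  by (rule finite_measure_sphere_measure)

text \<open>The density \<open>sin \<theta>\<close> is positive on the open rectangle of spherical coordinates, and that
  rectangle has positive area.\<close>

lemma measure_sphere_measure_pos: "0 < measure sphere_measure unit_sphere"
proof (rule ccontr)
  let ?d = "\<lambda>(\<theta>, \<phi>). ennreal (indicator ({0..pi} \<times> {0..2 * pi}) (\<theta>, \<phi>) * sin \<theta>)"
  assume "\<not> ?thesis"
  then have "(\<integral>\<^sup>+ x. ?d x \<partial>lborel) = 0"
    by (simp add: zero_less_measure_iff sphere_measure.emeasure_eq_measure
        flip: emeasure_sphere_measure_space)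
  then have "AE x in lborel. ?d x = 0"
    by (subst (asm) nn_integral_0_iff_AE) (use measurable_spherical_density in simp_all)
  then have "AE x in lborel. x \<notin> box (0,0) (pi, 2 * pi)"
  proof (rule AE_mp, intro AE_I2 impI notI)
    fix x assume "?d x = 0" "x \<in> box (0, 0) (pi, 2 * pi)"
    then show False
      using sin_gt_zero[of "fst x"] by (auto simp: mem_box Basis_prod_def indicator_def split: prod.splits)
  qed
  then have "emeasure lborel (box (0,0) (pi, 2 * pi)) = 0"
    by (subst (asm) AE_iff_measurable[OF _ refl]) auto
  then show False
    by (simp add: emeasure_lborel_box_eq Basis_prod_def prod.union_disjoint)
qed

text \<open>The only integrands below that are not continuous are those built from an arbitrary admissible
  density; for all others this settles integrability.\<close>

lemma integrable_continuous_on_sphere: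
  fixes f :: "real^3 \<Rightarrow> 'b::{banach, second_countable_topology}"
  assumes "continuous_on unit_sphere f"
  shows "integrable sphere_measure f"
proof -
  have "bounded (f ` unit_sphere)"
    by (intro compact_imp_bounded compact_continuous_image assms compact_sphere)
  then obtain B where "\<And>v. v \<in> unit_sphere \<Longrightarrow> norm (f v) \<le> B"
    unfolding bounded_iff by blast
  then show ?thesis
    using borel_measurable_continuous_on_restrict[OF assms]
    by (intro sphere_measure.integrable_const_bound[where B = B])
      (auto cong: measurable_cong_sets[OF sets_sphere_measure refl])
qed

lemma mean_pos:
  fixes f :: "real^3 \<Rightarrow> real"
  assumes f: "continuous_on unit_sphere f" and pos: "\<And>v. v \<in> unit_sphere \<Longrightarrow> 0 < f v"
  shows "0 < mean f"
proof -
  have "0 \<le> mean f"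
    by (intro Bochner_Integration.integral_nonneg less_imp_le pos) simp
  moreover have "mean f \<noteq> 0"
  proof
    assume "mean f = 0"
    moreover have "AE v in sphere_measure. 0 \<le> f v"
      using pos by (intro AE_I2 less_imp_le) simp
    ultimately have "AE v in sphere_measure. f v = 0"
      using integral_nonneg_eq_0_iff_AE[OF integrable_continuous_on_sphere[OF f]] by simp
    then have "AE v in sphere_measure. False"
      by (rule AE_mp) (intro AE_I2 impI, use pos in fastforce)
    then have "emeasure sphere_measure {v \<in> space sphere_measure. \<not> False} = 0"
      using sets.top[of sphere_measure] by (subst (asm) AE_iff_measurable[OF _ refl]) (simp_all add: sphere_def)
    then show False
      using measure_sphere_measure_pos by (simp add: measure_def sphere_def)
  qed
  ultimately show ?thesis by simp
qed

section \<open>Moments and the decomposition of moment vectors\<close>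

lemma continuous_on_real_sph_harm [continuous_intros]: "continuous_on S (real_sph_harm l k)"
proof -
  have "(\<lambda>v. Complex (v$1) (v$2) ^ a) = (\<lambda>v::real^3. (of_real (v$1) + \<i> * of_real (v$2)) ^ a)" for a
    by (simp add: complex_eq_iff fun_eq_iff Complex_eq)
  then have "continuous_on S (\<lambda>v::real^3. Complex (v$1) (v$2) ^ a)" for a
    by (simp only:) (intro continuous_intros)
  then show ?thesis
    unfolding real_sph_harm_def Let_def
    by (cases "k = 0"; cases "k > 0") (auto intro!: continuous_intros)
qed

lemma continuous_on_moments [continuous_intros]: "continuous_on S moments"
  unfolding moments_def sph_harm_nth_def Let_def
  by (intro continuous_on_vec_lambda continuous_on_real_sph_harm)

definition m0 :: real
  where "m0 = sqrt (1 / (4 * pi))"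

lemma m0_pos: "0 < m0"
  by (simp add: m0_def)

lemma moments_idx0 [simp]: "moments v $ idx0 = m0"
proof -
  have "position (idx0 :: 'a) = 0"
    by (auto simp: position_def idx0_def)
  then show ?thesis
    by (simp add: moments_def sph_harm_nth_def real_sph_harm_def legendre_poly_def m0_def)
qed

lemma sharp_nth: "sharp y $ i = (if i = idx0 then 0 else y $ i)"
  by (simp add: sharp_def)

lemma sharp_idempotent [simp]: "sharp (sharp y) = sharp y"
  by (simp add: vec_eq_iff sharp_nth)

lemma bounded_linear_sharp: "bounded_linear sharp"
  unfolding linear_conv_bounded_linear [symmetric]
  by (rule linearI) (simp_all add: vec_eq_iff sharp_nth)

lemmas sharp_add = linear_add [OF bounded_linear.linear [OF bounded_linear_sharp]]
lemmas sharp_scaleR = linear_cmul [OF bounded_linear.linear [OF bounded_linear_sharp]]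

lemma sharp_decomposition: "y = (y $ idx0) *\<^sub>R axis idx0 1 + sharp y"
  by (simp add: vec_eq_iff sharp_nth axis_def)

lemma sharp_inner_commute: "sharp x \<bullet> y = x \<bullet> sharp y"
  unfolding inner_vec_def by (intro sum.cong) (auto simp: sharp_nth)

lemma inner_sharp_sharp [simp]: "sharp x \<bullet> sharp y = sharp x \<bullet> y"
  by (simp add: sharp_inner_commute)

lemma inner_decomposition: "x \<bullet> y = x $ idx0 * y $ idx0 + sharp x \<bullet> y"
proof -
  have "x \<bullet> y = ((x $ idx0) *\<^sub>R axis idx0 1 + sharp x) \<bullet> y"
    by (simp flip: sharp_decomposition)
  then show ?thesis
    by (simp add: inner_add_left inner_axis')
qed

text \<open>Boundedness of sublevel sets is shown separately for the zeroth entry and the remaining ones.\<close>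

lemma norm_le_idx0_sharp: "norm y \<le> \<bar>y $ idx0\<bar> + norm (sharp y)"
  using norm_triangle_ineq[of "(y $ idx0) *\<^sub>R axis idx0 1" "sharp y"]
  by (simp flip: sharp_decomposition)

section \<open>Exponentially weighted means\<close>

lemma moments_bounded:
  obtains C where "0 \<le> C" "\<And>v. v \<in> unit_sphere \<Longrightarrow> norm (moments v :: real^'n::{finite, linorder}) \<le> C"
proof -
  have "bounded ((moments :: _ \<Rightarrow> real^'n::{finite, linorder}) ` unit_sphere)"
    by (intro compact_imp_bounded compact_continuous_image continuous_on_moments compact_sphere)
  then show thesis
    using that less_imp_le unfolding bounded_pos by (metis imageI)
qed

text \<open>The family of means with exponential weight is closed under differentiation in \<open>\<beta>\<close>: a
  derivative only multiplies \<open>w\<close> by a factor linear in the moments. The potential, its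
  derivatives and both fluxes are all expressed through it.\<close>

definition exp_mean :: "(real^3 \<Rightarrow> 'b::euclidean_space) \<Rightarrow> real^'n::{finite, linorder} \<Rightarrow> 'b"
  where "exp_mean w \<beta> = mean (\<lambda>v. exp (\<beta> \<bullet> moments v) *\<^sub>R w v)"

lemma exp_mean_integrable:
  fixes w :: "real^3 \<Rightarrow> 'b::euclidean_space"
  shows "continuous_on unit_sphere w \<Longrightarrow> integrable sphere_measure (\<lambda>v. exp (\<beta> \<bullet> moments v) *\<^sub>R w v)"
  by (intro integrable_continuous_on_sphere continuous_intros)

lemma exp_mean_bounded_linear:
  assumes "bounded_linear T" "continuous_on unit_sphere w"
  shows "T (exp_mean w \<beta>) = exp_mean (\<lambda>v. T (w v)) \<beta>"
proof -
  interpret T: bounded_linear T by fact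
  show ?thesis
    unfolding exp_mean_def
    using integral_bounded_linear[OF assms(1) exp_mean_integrable[OF assms(2)], of \<beta>]
    by (simp add: T.scaleR)
qed

lemma inner_exp_mean:
  assumes "continuous_on unit_sphere w"
  shows "d \<bullet> exp_mean w \<beta> = exp_mean (\<lambda>v. d \<bullet> w v) \<beta>"
  using exp_mean_bounded_linear[OF bounded_linear_inner_right assms] .

lemma exp_mean_scaleR:
  assumes "continuous_on unit_sphere w"
  shows "exp_mean (\<lambda>v. c *\<^sub>R w v) \<beta> = c *\<^sub>R exp_mean w \<beta>"
  using exp_mean_bounded_linear[OF bounded_linear_scaleR_right assms, of c \<beta>] by simp

lemma exp_mean_add:
  assumes "continuous_on unit_sphere w" "continuous_on unit_sphere w'"
  shows "exp_mean (\<lambda>v. w v + w' v) \<beta> = exp_mean w \<beta> + exp_mean w' \<beta>"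
  unfolding exp_mean_def scaleR_add_right
  by (intro Bochner_Integration.integral_add exp_mean_integrable assms)

lemma exp_mean_cong: "(\<And>v. w v = w' v) \<Longrightarrow> exp_mean w \<beta> = exp_mean w' \<beta>"
  by (simp add: exp_mean_def)

lemma exp_mean_nonneg: "(\<And>v. 0 \<le> w v) \<Longrightarrow> 0 \<le> exp_mean w \<beta>" for w :: "_ \<Rightarrow> real"
  unfolding exp_mean_def by (intro Bochner_Integration.integral_nonneg) simp

lemma exp_mean_pos:
  fixes w :: "_ \<Rightarrow> real"
  assumes "continuous_on unit_sphere w" "\<And>v. 0 < w v"
  shows "0 < exp_mean w \<beta>"
  unfolding exp_mean_def
  by (intro mean_pos continuous_intros assms) (simp add: assms)

text \<open>The moments are bounded on the sphere, so this bound makes the remainder quadratic in the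
  increment uniformly in \<open>v\<close>, which justifies differentiating under the integral sign.\<close>

lemma exp_remainder_le: "\<bar>exp y - 1 - y\<bar> \<le> y\<^sup>2 * exp \<bar>y\<bar>" for y :: real
proof -
  have lower: "0 \<le> exp y - 1 - y"
    using exp_ge_add_one_self[of y] by linarith
  have "(1 - y) * exp y \<le> exp (- y) * exp y"
    using exp_ge_add_one_self[of "- y"] by (intro mult_right_mono) auto
  then have ey: "exp y - 1 \<le> y * exp y"
    by (simp only: left_diff_distrib exp_add [symmetric]) simp
  have "y * (exp y - 1) \<le> y\<^sup>2 * exp \<bar>y\<bar>"
  proof (cases "0 \<le> y")
    case True
    then show ?thesis
      using mult_left_mono[OF ey True] by (simp add: power2_eq_square mult.assoc)
  next
    case False
    then have "y * (exp y - 1) \<le> y * y"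
      using lower by (intro mult_left_mono_neg) auto
    also have "\<dots> \<le> y\<^sup>2 * exp \<bar>y\<bar>"
      by (simp add: power2_eq_square mult_le_cancel_left1)
    finally show ?thesis .
  qed
  with ey lower show ?thesis
    by (simp add: algebra_simps)
qed

lemma exp_mean_has_derivative:
  fixes w :: "real^3 \<Rightarrow> 'b::euclidean_space" and \<beta> :: "real^'n::{finite, linorder}"
  assumes w: "continuous_on unit_sphere w"
  shows "(exp_mean w has_derivative (\<lambda>d. exp_mean (\<lambda>v. (d \<bullet> moments v) *\<^sub>R w v) \<beta>)) (at \<beta>)"
proof -
  obtain C where C: "0 \<le> C" "\<And>v. v \<in> unit_sphere \<Longrightarrow> norm (moments v :: real^'n::{finite, linorder}) \<le> C"
    using moments_bounded by blast
  let ?D = "\<lambda>d. exp_mean (\<lambda>v. (d \<bullet> moments v) *\<^sub>R w v) \<beta>"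
  \<comment> \<open>The integrated remainder is at most \<open>K\<close> times the squared norm of the increment.\<close>
  define K where "K = C\<^sup>2 * exp C * exp_mean (\<lambda>v. norm (w v)) \<beta>"
  have lin: "linear ?D"
    using w by (intro linearI)
      (simp_all add: inner_add_left scaleR_add_left exp_mean_add exp_mean_scaleR continuous_intros
        flip: scaleR_scaleR)
  have bound: "norm (exp_mean w \<beta>' - exp_mean w \<beta> - ?D (\<beta>' - \<beta>)) \<le> K * (norm (\<beta>' - \<beta>))\<^sup>2"
    if "norm (\<beta>' - \<beta>) \<le> 1" for \<beta>'
  proof -
    let ?y = "\<lambda>v. (\<beta>' - \<beta>) \<bullet> moments v"
    let ?r = "\<lambda>v. exp (\<beta> \<bullet> moments v) * (exp (?y v) - 1 - ?y v)"
    have "exp_mean w \<beta>' - exp_mean w \<beta> - ?D (\<beta>' - \<beta>)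
        = mean (\<lambda>v. exp (\<beta>' \<bullet> moments v) *\<^sub>R w v - exp (\<beta> \<bullet> moments v) *\<^sub>R w v
            - exp (\<beta> \<bullet> moments v) *\<^sub>R (?y v *\<^sub>R w v))"
      unfolding exp_mean_def
      by (subst Bochner_Integration.integral_diff;
          (intro Bochner_Integration.integrable_diff exp_mean_integrable continuous_intros w)?)
        (subst Bochner_Integration.integral_diff;
          (intro Bochner_Integration.integrable_diff exp_mean_integrable continuous_intros w)?; simp)
    also have "\<dots> = mean (\<lambda>v. ?r v *\<^sub>R w v)"
      by (intro Bochner_Integration.integral_cong refl)
        (simp add: algebra_simps flip: exp_add)
    also have "norm \<dots> \<le> mean (\<lambda>v. C\<^sup>2 * exp C * (norm (\<beta>' - \<beta>))\<^sup>2 * (exp (\<beta> \<bullet> moments v) * norm (w v)))"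
    proof (rule Bochner_Integration.integral_norm_bound_integral)
      show "integrable sphere_measure (\<lambda>v. ?r v *\<^sub>R w v)"
        by (intro integrable_continuous_on_sphere continuous_intros w)
      show "integrable sphere_measure
          (\<lambda>v. C\<^sup>2 * exp C * (norm (\<beta>' - \<beta>))\<^sup>2 * (exp (\<beta> \<bullet> moments v) * norm (w v)))"
        by (intro integrable_continuous_on_sphere continuous_intros w)
      fix v assume "v \<in> space sphere_measure"
      then have m: "norm (moments v :: real^'n::{finite, linorder}) \<le> C"
        using C(2) by simp
      have y: "\<bar>?y v\<bar> \<le> C * norm (\<beta>' - \<beta>)"
        using Cauchy_Schwarz_ineq2[of "\<beta>' - \<beta>" "moments v"] mult_left_mono[OF m norm_ge_zero[of "\<beta>' - \<beta>"]]
        by (simp add: mult.commute)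
      also have "\<dots> \<le> C"
        using that C(1) by (simp add: mult_left_le)
      finally have "exp \<bar>?y v\<bar> \<le> exp C"
        by simp
      moreover have "(?y v)\<^sup>2 \<le> C\<^sup>2 * (norm (\<beta>' - \<beta>))\<^sup>2"
        using power_mono[OF y, of 2] by (simp add: power_mult_distrib)
      ultimately have "(?y v)\<^sup>2 * exp \<bar>?y v\<bar> \<le> C\<^sup>2 * (norm (\<beta>' - \<beta>))\<^sup>2 * exp C"
        by (intro mult_mono) auto
      with exp_remainder_le[of "?y v"]
      have "\<bar>exp (?y v) - 1 - ?y v\<bar> \<le> C\<^sup>2 * (norm (\<beta>' - \<beta>))\<^sup>2 * exp C"
        by linarith
      from mult_right_mono[OF this, of "exp (\<beta> \<bullet> moments v) * norm (w v)"]
      show "norm (?r v *\<^sub>R w v)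
          \<le> C\<^sup>2 * exp C * (norm (\<beta>' - \<beta>))\<^sup>2 * (exp (\<beta> \<bullet> moments v) * norm (w v))"
        by (simp add: abs_mult mult_ac)
    qed
    also have "\<dots> = K * (norm (\<beta>' - \<beta>))\<^sup>2"
      by (simp add: K_def exp_mean_def)
    finally show ?thesis .
  qed
  show ?thesis
  proof (rule has_derivativeI_sandwich[where e = 1 and H = "\<lambda>y. K * norm (y - \<beta>)"])
    show "bounded_linear ?D"
      using lin by (simp add: linear_conv_bounded_linear)
    show "norm (exp_mean w y - exp_mean w \<beta> - ?D (y - \<beta>)) / norm (y - \<beta>) \<le> K * norm (y - \<beta>)"
      if "y \<noteq> \<beta>" "dist y \<beta> < 1" for y
      using bound[of y] that by (simp add: divide_le_eq power2_eq_square dist_norm mult.assoc)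
    show "((\<lambda>y. K * norm (y - \<beta>)) \<longlongrightarrow> 0) (at \<beta>)"
      by (auto intro!: tendsto_eq_intros)
  qed simp
qed

section \<open>The dual potential\<close>

text \<open>As \<open>sharp \<beta> \<bullet> \<beta>\<close> is the squared norm of \<open>sharp \<beta>\<close>, this is the factor that turns the ansatz
  \<open>exp (\<beta> \<bullet> m)\<close> into the optimal density of the regularized problem. The parameter \<open>\<kappa>\<close> stands
  for \<open>m\<^sub>0 \<gamma>\<close>.\<close>

definition gauss_factor :: "real \<Rightarrow> real^'n::{finite, linorder} \<Rightarrow> real"
  where "gauss_factor \<kappa> \<beta> = exp (\<kappa> / 2 * (sharp \<beta> \<bullet> \<beta>))"

definition potential :: "real \<Rightarrow> real^'n::{finite, linorder} \<Rightarrow> real"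
  where "potential \<kappa> \<beta> = gauss_factor \<kappa> \<beta> * exp_mean (\<lambda>_. 1) \<beta>"

definition potential_grad :: "real \<Rightarrow> real^'n::{finite, linorder} \<Rightarrow> real^'n::{finite, linorder}"
  where "potential_grad \<kappa> \<beta> =
    gauss_factor \<kappa> \<beta> *\<^sub>R (exp_mean moments \<beta> + (\<kappa> * exp_mean (\<lambda>_. 1) \<beta>) *\<^sub>R sharp \<beta>)"

text \<open>The last summand comes from differentiating the Gaussian factor; the form that shows symmetry
  and definiteness is given in \<open>inner_potential_hess\<close>.\<close>

definition potential_hess :: "real \<Rightarrow> real^'n::{finite, linorder} \<Rightarrow> real^'n::{finite, linorder} \<Rightarrow> real^'n::{finite, linorder}"
  where "potential_hess \<kappa> \<beta> d =
    gauss_factor \<kappa> \<beta> *\<^sub>R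
      (exp_mean (\<lambda>v. (d \<bullet> moments v) *\<^sub>R moments v) \<beta>
       + ((\<kappa> * exp_mean (\<lambda>v. d \<bullet> moments v) \<beta>) *\<^sub>R sharp \<beta> + (\<kappa> * exp_mean (\<lambda>_. 1) \<beta>) *\<^sub>R sharp d))
    + (\<kappa> * (sharp \<beta> \<bullet> d) * gauss_factor \<kappa> \<beta>) *\<^sub>R
      (exp_mean moments \<beta> + (\<kappa> * exp_mean (\<lambda>_. 1) \<beta>) *\<^sub>R sharp \<beta>)"

lemma gauss_factor_pos [simp]: "0 < gauss_factor \<kappa> \<beta>"
  by (simp add: gauss_factor_def)

lemma gauss_factor_has_derivative:
  "(gauss_factor \<kappa> has_derivative (\<lambda>d. \<kappa> * (sharp \<beta> \<bullet> d) * gauss_factor \<kappa> \<beta>)) (at \<beta>)"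
proof -
  have "sharp d \<bullet> \<beta> = sharp \<beta> \<bullet> d" for d
    by (metis sharp_inner_commute inner_commute)
  moreover have "((\<lambda>\<beta>. sharp \<beta> \<bullet> \<beta>) has_derivative (\<lambda>d. sharp \<beta> \<bullet> d + sharp d \<bullet> \<beta>)) (at \<beta>)"
    by (intro has_derivative_inner bounded_linear.has_derivative[OF bounded_linear_sharp]
        has_derivative_ident)
  ultimately have [derivative_intros]:
    "((\<lambda>\<beta>. sharp \<beta> \<bullet> \<beta>) has_derivative (\<lambda>d. 2 * (sharp \<beta> \<bullet> d))) (at \<beta>)"
    by (simp only: mult_2)
  show ?thesis
    unfolding gauss_factor_def by (auto intro!: derivative_eq_intros)
qed

lemma exp_mean_one_pos: "0 < exp_mean (\<lambda>_. 1 :: real) \<beta>"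
  by (intro exp_mean_pos continuous_intros) simp

lemma potential_pos: "0 < potential \<kappa> \<beta>"
  by (simp add: potential_def exp_mean_one_pos)

lemma potential_has_derivative:
  "(potential \<kappa> has_derivative (\<lambda>d. d \<bullet> potential_grad \<kappa> \<beta>)) (at \<beta>)"
  unfolding potential_def
  by (rule has_derivative_eq_rhs, rule has_derivative_mult[OF gauss_factor_has_derivative
        exp_mean_has_derivative], intro continuous_intros)
    (simp add: fun_eq_iff potential_grad_def inner_add_right inner_exp_mean continuous_on_moments
      inner_commute[of "sharp \<beta>"] algebra_simps)

lemma potential_grad_has_derivative:
  "(potential_grad \<kappa> has_derivative potential_hess \<kappa> \<beta>) (at \<beta>)"
proof -
  note [derivative_intros] = gauss_factor_has_derivative
    exp_mean_has_derivative[OF continuous_on_moments]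
    exp_mean_has_derivative[OF continuous_on_const]
    bounded_linear.has_derivative[OF bounded_linear_sharp]
  have "((\<lambda>\<beta>. gauss_factor \<kappa> \<beta> *\<^sub>R (exp_mean moments \<beta> + (\<kappa> * exp_mean (\<lambda>_. 1) \<beta>) *\<^sub>R sharp \<beta>))
      has_derivative potential_hess \<kappa> \<beta>) (at \<beta>)"
    by (rule has_derivative_eq_rhs, (rule derivative_intros)+)
      (simp add: fun_eq_iff potential_hess_def scaleR_add_right scaleR_add_left add_ac)
  then show ?thesis
    by (simp add: potential_grad_def[abs_def])
qed

text \<open>The exponent \<open>\<beta> \<bullet> m + \<kappa> / 2 * \<parallel>\<beta>\<^sub>#\<parallel>\<^sup>2\<close> of the integrand has the gradient \<open>m + \<kappa> \<beta>\<^sub>#\<close> and the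
  second derivative \<open>\<kappa>\<close> on the entries but the zeroth. The Hessian of the exponential is the
  exponential times the sum of the squared gradient and the second derivative.\<close>

lemma inner_potential_hess:
  "e \<bullet> potential_hess \<kappa> \<beta> d = gauss_factor \<kappa> \<beta> *
     (exp_mean (\<lambda>v. (d \<bullet> moments v + \<kappa> * (sharp \<beta> \<bullet> d)) * (e \<bullet> moments v + \<kappa> * (sharp \<beta> \<bullet> e))) \<beta>
      + \<kappa> * exp_mean (\<lambda>_. 1) \<beta> * (e \<bullet> sharp d))"
proof -
  let ?a = "\<kappa> * (sharp \<beta> \<bullet> d)" and ?b = "\<kappa> * (sharp \<beta> \<bullet> e)"
  have "exp_mean (\<lambda>v. (d \<bullet> moments v + ?a) * (e \<bullet> moments v + ?b)) \<beta>
      = exp_mean (\<lambda>v. (d \<bullet> moments v) * (e \<bullet> moments v) + (?b *\<^sub>R (d \<bullet> moments v)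
          + (?a *\<^sub>R (e \<bullet> moments v) + (?a * ?b) *\<^sub>R 1))) \<beta>"
    by (intro exp_mean_cong) (simp add: algebra_simps)
also have "\<dots> = exp_mean (\<lambda>v. (d \<bullet> moments v) * (e \<bullet> moments v)) \<beta>
      + (?b *\<^sub>R exp_mean (\<lambda>v. d \<bullet> moments v) \<beta>
          + (?a *\<^sub>R exp_mean (\<lambda>v. e \<bullet> moments v) \<beta> + (?a * ?b) *\<^sub>R exp_mean (\<lambda>_. 1) \<beta>))"
    using continuous_on_moments by (subst exp_mean_add exp_mean_scaleR; (intro continuous_intros)?)+ (rule refl)
  finally have "exp_mean (\<lambda>v. (d \<bullet> moments v + ?a) * (e \<bullet> moments v + ?b)) \<beta> = \<dots>" .
  moreover have "e \<bullet> exp_mean (\<lambda>v. (d \<bullet> moments v) *\<^sub>R moments v) \<beta>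
      = exp_mean (\<lambda>v. (d \<bullet> moments v) * (e \<bullet> moments v)) \<beta>"
    using inner_exp_mean[where w="\<lambda>v. (d \<bullet> moments v) *\<^sub>R moments v" and d=e and \<beta>=\<beta>]
    by (simp add: continuous_on_scaleR continuous_on_inner continuous_on_moments)
  moreover have "e \<bullet> exp_mean moments \<beta> = exp_mean (\<lambda>v. e \<bullet> moments v) \<beta>"
    by (rule inner_exp_mean[OF continuous_on_moments])
  ultimately show ?thesis
    by (simp add: potential_hess_def inner_add_right inner_commute[of "sharp \<beta>"] algebra_simps)
qed

lemma potential_hess_symmetric: "e \<bullet> potential_hess \<kappa> \<beta> d = d \<bullet> potential_hess \<kappa> \<beta> e"
proof -
  have "e \<bullet> sharp d = d \<bullet> sharp e"
    by (metis sharp_inner_commute inner_commute)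
  then show ?thesis
    by (simp add: inner_potential_hess mult.commute)
qed

text \<open>The term with \<open>sharp d\<close> is positive unless \<open>d\<close> is a multiple of the zeroth unit vector, and in
  that direction the exponent is linear with the nonzero slope \<open>m\<^sub>0\<close>.\<close>

lemma potential_hess_pos:
  assumes "0 < \<kappa>" "d \<noteq> 0"
  shows "0 < d \<bullet> potential_hess \<kappa> \<beta> d"
proof (cases "sharp d = 0")
  case True
  with \<open>d \<noteq> 0\<close> have "d $ idx0 \<noteq> 0"
    using sharp_decomposition[of d] by auto
  moreover have "d \<bullet> moments v + \<kappa> * (sharp \<beta> \<bullet> d) = d $ idx0 * m0" for v
    using inner_decomposition[of d "moments v"] by (simp add: True sharp_inner_commute)
  ultimately have "0 < exp_mean (\<lambda>v. (d \<bullet> moments v + \<kappa> * (sharp \<beta> \<bullet> d))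
      * (d \<bullet> moments v + \<kappa> * (sharp \<beta> \<bullet> d))) \<beta>"
    using m0_pos by (intro exp_mean_pos continuous_intros) (auto simp: zero_less_mult_iff mult_less_0_iff linorder_neq_iff)
  then show ?thesis
    by (simp add: inner_potential_hess True)
next
  case False
  have "0 \<le> exp_mean (\<lambda>v. (d \<bullet> moments v + \<kappa> * (sharp \<beta> \<bullet> d))
      * (d \<bullet> moments v + \<kappa> * (sharp \<beta> \<bullet> d))) \<beta>"
    by (intro exp_mean_nonneg) simp
  moreover have "0 < d \<bullet> sharp d"
    using False by (metis inner_commute inner_gt_zero_iff inner_sharp_sharp)
  ultimately show ?thesis
    using \<open>0 < \<kappa>\<close> by (simp add: inner_potential_hess exp_mean_one_pos add_nonneg_pos)
qed

text \<open>Along the segment between two points the component of the gradient in the direction of the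
  segment is strictly increasing, since its derivative is the Hessian form.\<close>

lemma inj_potential_grad:
  assumes "0 < \<kappa>"
  shows "inj (potential_grad \<kappa>)"
proof (rule injI, rule ccontr)
  fix \<beta> \<beta>' :: "real^'n::{finite, linorder}"
  assume eq: "potential_grad \<kappa> \<beta> = potential_grad \<kappa> \<beta>'" and "\<beta> \<noteq> \<beta>'"
  let ?d = "\<beta>' - \<beta>"
  let ?g = "\<lambda>t. potential_grad \<kappa> (\<beta> + t *\<^sub>R ?d) \<bullet> ?d"
  have "(?g has_real_derivative ?d \<bullet> potential_hess \<kappa> (\<beta> + t *\<^sub>R ?d) ?d) (at t)" for t
  proof -
    have "((\<lambda>t. \<beta> + t *\<^sub>R ?d) has_derivative (\<lambda>s. s *\<^sub>R ?d)) (at t)"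
      by (auto intro!: derivative_eq_intros)
    from has_derivative_compose[OF this potential_grad_has_derivative]
    have "(?g has_derivative (\<lambda>s. potential_hess \<kappa> (\<beta> + t *\<^sub>R ?d) (s *\<^sub>R ?d) \<bullet> ?d)) (at t)"
      by (rule has_derivative_inner_left)
    moreover have "potential_hess \<kappa> (\<beta> + t *\<^sub>R ?d) (s *\<^sub>R ?d) \<bullet> ?d
        = (?d \<bullet> potential_hess \<kappa> (\<beta> + t *\<^sub>R ?d) ?d) * s" for s
      using potential_hess_symmetric[of ?d \<kappa> "\<beta> + t *\<^sub>R ?d" "s *\<^sub>R ?d"] by (simp add: inner_commute)
    ultimately show ?thesis
      by (simp add: has_field_derivative_def)
  qed
  moreover have "0 < ?d \<bullet> potential_hess \<kappa> (\<beta> + t *\<^sub>R ?d) ?d" for t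
    using assms \<open>\<beta> \<noteq> \<beta>'\<close> by (intro potential_hess_pos) auto
  ultimately have "?g 0 < ?g 1"
    by (intro DERIV_pos_imp_increasing[of 0 1 ?g]) auto
  with eq show False
    by simp
qed

lemma gauss_factor_exp_mean:
  "gauss_factor \<kappa> \<beta> *\<^sub>R exp_mean w \<beta> = mean (\<lambda>v. exp (\<beta> \<bullet> moments v + \<kappa> / 2 * (sharp \<beta> \<bullet> \<beta>)) *\<^sub>R w v)"
proof -
  have "exp (\<beta> \<bullet> moments v + \<kappa> / 2 * (sharp \<beta> \<bullet> \<beta>)) *\<^sub>R w v
      = gauss_factor \<kappa> \<beta> *\<^sub>R (exp (\<beta> \<bullet> moments v) *\<^sub>R w v)" for v
    by (simp add: gauss_factor_def exp_add mult.commute)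
  then show ?thesis
    by (simp only: exp_mean_def integral_scaleR_right)
qed

section \<open>The gradient of the potential is onto the states\<close>

lemma sharp_inner_self: "sharp \<beta> \<bullet> \<beta> = (norm (sharp \<beta>))\<^sup>2"
  by (simp add: power2_norm_eq_inner)

text \<open>Bounding \<open>sharp \<beta> \<bullet> m\<close> by Cauchy-Schwarz loses a term linear in \<open>\<parallel>\<beta>\<^sub>#\<parallel>\<close>, which for \<open>\<kappa> > 0\<close>
  the quadratic term of the exponent dominates.\<close>

lemma potential_ge_exp:
  obtains A C where "0 < A" "0 \<le> C"
    "\<And>\<beta> :: real^'n::{finite, linorder}.
       A * exp (m0 * \<beta> $ idx0 + \<kappa> / 2 * (norm (sharp \<beta>))\<^sup>2 - C * norm (sharp \<beta>)) \<le> potential \<kappa> \<beta>"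
proof -
  obtain C where C: "0 \<le> C" "\<And>v. v \<in> unit_sphere \<Longrightarrow> norm (moments v :: real^'n::{finite, linorder}) \<le> C"
    using moments_bounded by blast
  define A where "A = measure sphere_measure unit_sphere"
  show thesis
  proof (rule that)
    show "0 < A" "0 \<le> C"
      using measure_sphere_measure_pos C by (simp_all add: A_def)
    fix \<beta> :: "real^'n::{finite, linorder}"
    have "mean (\<lambda>v. exp (m0 * \<beta> $ idx0 - C * norm (sharp \<beta>))) \<le> mean (\<lambda>v. exp (\<beta> \<bullet> moments v))"
    proof (rule integral_mono)
      fix v assume "v \<in> space sphere_measure"
      then have "norm (sharp \<beta>) * norm (moments v :: real^'n::{finite, linorder}) \<le> norm (sharp \<beta>) * C"
        using C(2) by (intro mult_left_mono) auto
      then have "- (C * norm (sharp \<beta>)) \<le> sharp \<beta> \<bullet> moments v"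
        using Cauchy_Schwarz_ineq2[of "sharp \<beta>" "moments v"] by (simp add: mult.commute)
      then show "exp (m0 * \<beta> $ idx0 - C * norm (sharp \<beta>)) \<le> exp (\<beta> \<bullet> moments v)"
        by (simp add: inner_decomposition[of \<beta>] mult.commute)
    qed (intro integrable_continuous_on_sphere continuous_intros)+
    then have "A * exp (m0 * \<beta> $ idx0 - C * norm (sharp \<beta>)) \<le> exp_mean (\<lambda>_. 1) \<beta>"
      by (simp add: exp_mean_def A_def)
    from mult_left_mono[OF this less_imp_le[OF gauss_factor_pos[of \<kappa> \<beta>]]]
    show "A * exp (m0 * \<beta> $ idx0 + \<kappa> / 2 * (norm (sharp \<beta>))\<^sup>2 - C * norm (sharp \<beta>)) \<le> potential \<kappa> \<beta>"
      by (simp add: potential_def gauss_factor_def sharp_inner_self exp_add exp_diff mult_ac)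
  qed
qed

text \<open>For \<open>s \<ge> 0\<close> the exponential lies above its tangent of slope \<open>2 a\<close>; for \<open>s \<le> 0\<close> the linear term
  suffices.\<close>

lemma exp_minus_linear_coercive:
  fixes a A :: real
  assumes "0 < a" "0 < A"
  obtains K where "\<And>s. a * \<bar>s\<bar> - K \<le> A * exp s - a * s"
proof (rule that)
  let ?l = "ln (2 * a / A)"
  fix s :: real
  show "a * \<bar>s\<bar> - 2 * (a * \<bar>?l\<bar>) \<le> A * exp s - a * s"
  \<comment> \<open>The tangent of slope \<open>2 a\<close> touches \<open>A exp s\<close> at \<open>s = ?l\<close>.\<close>
  proof (cases "0 \<le> s")
    case True
    have "2 * a * (1 + (s - ?l)) \<le> 2 * a * exp (s - ?l)"
      using assms by (intro mult_left_mono exp_ge_add_one_self) auto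
    also have "\<dots> = A * exp s"
      using assms by (simp add: exp_diff)
    finally have "2 * a + 2 * (a * s) - 2 * (a * ?l) \<le> A * exp s"
      by (simp add: algebra_simps)
    moreover have "a * ?l \<le> a * \<bar>?l\<bar>"
      using assms by (intro mult_left_mono) auto
    ultimately show ?thesis
      unfolding abs_of_nonneg[OF True] using assms by linarith
  next
    case False
    then have "a * \<bar>s\<bar> = - (a * s)"
      by simp
    moreover have "0 \<le> a * \<bar>?l\<bar>" "0 \<le> A * exp s"
      using assms by simp_all
    ultimately show ?thesis
      by linarith
  qed
qed

text \<open>Let \<open>s\<close> be the exponent in \<open>potential_ge_exp\<close> and \<open>r = \<parallel>\<beta>\<^sub>#\<parallel>\<close>. Expressing the zeroth entry of
  \<open>\<beta>\<close> by \<open>s\<close> and \<open>r\<close> turns \<open>-\<beta>\<^sub>0 u\<^sub>0\<close> into \<open>-a s\<close> plus a positive multiple of \<open>r\<^sup>2\<close>, because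
  \<open>u\<^sub>0 > 0\<close>, up to a term linear in \<open>r\<close>. Then \<open>A exp s - a s\<close> controls \<open>\<bar>s\<bar>\<close>, and the quadratic term controls \<open>r\<close>.\<close>

lemma sublevel_potential_bounded:
  fixes u :: "real^'n::{finite, linorder}"
  assumes \<kappa>: "0 < \<kappa>" and u: "u \<in> states"
  shows "bounded {\<beta>. potential \<kappa> \<beta> - \<beta> \<bullet> u \<le> c}"
proof -
  obtain A C where "0 < A" "0 \<le> C" and P: "\<And>\<beta> :: real^'n::{finite, linorder}.
       A * exp (m0 * \<beta> $ idx0 + \<kappa> / 2 * (norm (sharp \<beta>))\<^sup>2 - C * norm (sharp \<beta>)) \<le> potential \<kappa> \<beta>"
    using potential_ge_exp by blast
  define a where "a = u $ idx0 / m0"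
  have "0 < a"
    using u m0_pos by (simp add: a_def states_def)
  obtain K where K: "\<And>s. a * \<bar>s\<bar> - K \<le> A * exp s - a * s"
    using exp_minus_linear_coercive[OF \<open>0 < a\<close> \<open>0 < A\<close>] by blast
  define p where "p = a * \<kappa> / 2"
  define D where "D = a * C + norm u"
  define L where "L = c + K + D\<^sup>2 / (2 * p)"
  define R where "R = 1 + 2 * L / p"
  have "0 < p"
    using \<open>0 < a\<close> \<kappa> by (simp add: p_def)
  have "norm \<beta> \<le> (L / a + \<kappa> / 2 * (2 * L / p) + C * R) / m0 + R"
    if le: "potential \<kappa> \<beta> - \<beta> \<bullet> u \<le> c" for \<beta>
  proof -
    define r where "r = norm (sharp \<beta>)"
    define s where "s = m0 * \<beta> $ idx0 + \<kappa> / 2 * r\<^sup>2 - C * r"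
    have "0 \<le> r"
      by (simp add: r_def)
    have "sharp \<beta> \<bullet> u \<le> r * norm u"
      unfolding r_def by (rule norm_cauchy_schwarz)
    moreover have "\<beta> $ idx0 * u $ idx0 = a * (m0 * \<beta> $ idx0)"
      using m0_pos by (simp add: a_def)
    then have "\<beta> $ idx0 * u $ idx0 = a * (s - \<kappa> / 2 * r\<^sup>2 + C * r)"
      by (simp add: s_def)
    ultimately have "\<beta> \<bullet> u \<le> a * (s - \<kappa> / 2 * r\<^sup>2 + C * r) + r * norm u"
      by (simp add: inner_decomposition[of \<beta>])
    then have "\<beta> \<bullet> u \<le> a * s - p * r\<^sup>2 + D * r"
      by (simp add: p_def D_def algebra_simps)
    moreover have "A * exp s \<le> potential \<kappa> \<beta>"
      using P[of \<beta>] by (simp add: s_def r_def)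
    ultimately have 1: "a * \<bar>s\<bar> - K + p * r\<^sup>2 - D * r \<le> c"
      using K[of s] le by linarith
    \<comment> \<open>Half of the quadratic term absorbs the linear one.\<close>
    have "0 \<le> (p * r - D)\<^sup>2 / (2 * p)"
      using \<open>0 < p\<close> by simp
    also have "\<dots> = p / 2 * r\<^sup>2 + D\<^sup>2 / (2 * p) - D * r"
      using \<open>0 < p\<close> by (simp add: power2_eq_square field_simps)
    finally have 2: "a * \<bar>s\<bar> + p / 2 * r\<^sup>2 \<le> L"
      using 1 by (simp add: L_def)
    have "0 \<le> a * \<bar>s\<bar>" "0 \<le> p / 2 * r\<^sup>2"
      using \<open>0 < a\<close> \<open>0 < p\<close> by simp_all
    with 2 have "a * \<bar>s\<bar> \<le> L" "p / 2 * r\<^sup>2 \<le> L"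
      by linarith+
    then have s: "\<bar>s\<bar> \<le> L / a" and r2: "r\<^sup>2 \<le> 2 * L / p"
      using \<open>0 < a\<close> \<open>0 < p\<close> by (simp_all add: field_simps)
    \<comment> \<open>From \<open>r\<^sup>2\<close> back to \<open>r\<close>, by \<open>2 r \<le> 1 + r\<^sup>2\<close>.\<close>
    have "0 \<le> (r - 1)\<^sup>2" by simp
    then have r: "r \<le> R"
      using r2 \<open>0 \<le> r\<close> by (simp add: R_def power2_diff)
    have "\<bar>m0 * \<beta> $ idx0\<bar> \<le> \<bar>s\<bar> + \<kappa> / 2 * r\<^sup>2 + C * r"
    proof -
      have "0 \<le> \<kappa> / 2 * r\<^sup>2" "0 \<le> C * r"
        using \<open>0 \<le> r\<close> \<open>0 \<le> C\<close> \<kappa> by simp_all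
      then show ?thesis
        unfolding s_def by linarith
    qed
    also have "\<dots> \<le> L / a + \<kappa> / 2 * (2 * L / p) + C * R"
      using \<kappa> \<open>0 \<le> C\<close> by (intro add_mono s mult_left_mono r r2) auto
    finally have "\<bar>\<beta> $ idx0\<bar> \<le> (L / a + \<kappa> / 2 * (2 * L / p) + C * R) / m0"
      using m0_pos by (simp add: abs_mult le_divide_eq mult.commute)
    then show ?thesis
      using norm_le_idx0_sharp[of \<beta>] r by (simp add: r_def)
  qed
  then show ?thesis
    unfolding bounded_iff by blast
qed

lemma potential_grad_surj_states:
  fixes u :: "real^'n::{finite, linorder}"
  assumes "0 < \<kappa>" and "u \<in> states"
  obtains \<beta> where "potential_grad \<kappa> \<beta> = u"
proof -
  let ?\<Psi> = "\<lambda>\<beta>. potential \<kappa> \<beta> - \<beta> \<bullet> u"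
  let ?S = "{\<beta>. ?\<Psi> \<beta> \<le> ?\<Psi> 0}"
  have der: "(?\<Psi> has_derivative (\<lambda>d. d \<bullet> potential_grad \<kappa> \<beta> - d \<bullet> u)) (at \<beta>)" for \<beta>
    by (intro has_derivative_diff potential_has_derivative has_derivative_inner_left has_derivative_ident)
  then have cont: "continuous_on UNIV ?\<Psi>"
    using has_derivative_continuous by (blast intro: continuous_at_imp_continuous_on)
  then have "compact ?S"
    using sublevel_potential_bounded[OF assms] by (simp add: compact_eq_bounded_closed closed_Collect_le)
  moreover have "0 \<in> ?S"
    by simp
  ultimately obtain \<beta> where "\<beta> \<in> ?S" "\<And>\<beta>'. \<beta>' \<in> ?S \<Longrightarrow> ?\<Psi> \<beta> \<le> ?\<Psi> \<beta>'"
    using continuous_attains_inf[of ?S ?\<Psi>] continuous_on_subset[OF cont] by blast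
  then have min: "?\<Psi> \<beta> \<le> ?\<Psi> \<beta>'" for \<beta>'
    by (cases "\<beta>' \<in> ?S") force+
  have "(\<lambda>d. d \<bullet> potential_grad \<kappa> \<beta> - d \<bullet> u) = (\<lambda>d. 0)"
    by (rule has_derivative_local_min[OF der]) (simp add: min)
  then have "d \<bullet> potential_grad \<kappa> \<beta> = d \<bullet> u" for d
    by (simp add: fun_eq_iff)
  then show thesis
    using that vector_eq_ldot by blast
qed

section \<open>Strong duality\<close>

lemma fenchel_young_entropy:
  assumes "0 \<le> z"
  shows "z * y - exp y \<le> \<eta> z"
proof (cases "z = 0")
  case False
  with assms have "0 < z" by simp
  then have "z * (1 + (y - ln z)) \<le> z * exp (y - ln z)"
    by (intro mult_left_mono exp_ge_add_one_self) auto
  also have "\<dots> = exp y"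
    using \<open>0 < z\<close> by (simp add: exp_diff)
  finally show ?thesis
    by (simp add: \<eta>_def algebra_simps)
qed (simp add: \<eta>_def)

lemma mean_sharp:
  assumes "integrable sphere_measure G"
  shows "mean (\<lambda>v. sharp (G v)) = sharp (mean G)"
  by (rule integral_bounded_linear[OF bounded_linear_sharp assms])

text \<open>Two Young inequalities are added: the one for \<open>\<eta>\<close> and its dual \<open>exp\<close>, at the exponent of the
  optimal density and integrated over the sphere, and the one for the squared norm with weight
  \<open>c = u\<^sub>0 \<gamma>\<close>. The constraint on the zeroth moment turns the constant part of the exponent into
  exactly the quadratic term that the second inequality needs.\<close>

lemma weak_duality:
  fixes u \<beta> :: "real^'n::{finite, linorder}"
  assumes \<gamma>: "0 < \<gamma>" and u: "u \<in> states" and g: "g \<in> admissible u"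
  shows "\<beta> \<bullet> u - potential (m0 * \<gamma>) \<beta> \<le> objective \<gamma> u g"
proof -
  let ?q = "m0 * \<gamma> / 2 * (sharp \<beta> \<bullet> \<beta>)"
  let ?y = "\<lambda>v. \<beta> \<bullet> moments v + ?q"
  define G where "G = mean (\<lambda>v. g v *\<^sub>R (moments v :: real^'n::{finite, linorder}))"
  define c where "c = u $ idx0 * \<gamma>"
  have "0 < c"
    using \<gamma> u by (simp add: c_def states_def)
  have intm: "integrable sphere_measure (\<lambda>v. g v *\<^sub>R (moments v :: real^'n::{finite, linorder}))"
    and int\<eta>: "integrable sphere_measure (\<lambda>v. \<eta> (g v))"
    and nonneg: "\<And>v. v \<in> unit_sphere \<Longrightarrow> 0 \<le> g v"
    and u0: "m0 * mean g = u $ idx0"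
    using g by (auto simp: admissible_def)
  have G0: "axis idx0 1 \<bullet> G = m0 * mean g"
    unfolding G_def by (subst integral_inner_right[symmetric], use intm in simp) (simp add: inner_axis' mult.commute)
  have "integrable sphere_measure (\<lambda>v. (1 / m0) * (axis idx0 1 \<bullet> (g v *\<^sub>R (moments v :: real^'n::{finite, linorder}))))"
    using intm by (intro integrable_mult_right integrable_inner_right)
  then have intg: "integrable sphere_measure g"
    using m0_pos by (simp add: inner_axis')
  have gy: "(\<lambda>v. g v * ?y v) = (\<lambda>v. \<beta> \<bullet> (g v *\<^sub>R moments v) + ?q * g v)"
    by (simp add: algebra_simps)
  have intgy: "integrable sphere_measure (\<lambda>v. g v * ?y v)"
    unfolding gy using intm intg by (intro Bochner_Integration.integrable_add integrable_inner_right integrable_mult_right)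
  have inte: "integrable sphere_measure (\<lambda>v. exp (?y v))"
    by (intro integrable_continuous_on_sphere continuous_intros)
  have "mean (\<lambda>v. g v * ?y v) = \<beta> \<bullet> G + ?q * mean g"
    unfolding gy G_def using intm intg
    by (subst Bochner_Integration.integral_add) (simp_all del: inner_scaleR_right)
  also have "?q * mean g = c / 2 * (sharp \<beta> \<bullet> \<beta>)"
    using u0 by (simp add: c_def)
  also have "\<beta> \<bullet> G = \<beta> $ idx0 * u $ idx0 + sharp \<beta> \<bullet> sharp G"
    using G0 u0 by (simp add: inner_decomposition[of \<beta>] inner_axis')
  finally have gy_eq: "mean (\<lambda>v. g v * ?y v)
      = \<beta> $ idx0 * u $ idx0 + sharp \<beta> \<bullet> sharp G + c / 2 * (sharp \<beta> \<bullet> \<beta>)" .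
  have pot: "potential (m0 * \<gamma>) \<beta> = mean (\<lambda>v. exp (?y v))"
    using gauss_factor_exp_mean[of "m0 * \<gamma>" \<beta> "\<lambda>_. 1::real"] by (simp add: potential_def)
  have "mean (\<lambda>v. g v * ?y v) - mean (\<lambda>v. exp (?y v)) = mean (\<lambda>v. g v * ?y v - exp (?y v))"
    using intgy inte by simp
  also have "\<dots> \<le> mean (\<lambda>v. \<eta> (g v))"
    using intgy inte int\<eta> fenchel_young_entropy nonneg by (intro integral_mono) auto
  finally have 1: "\<beta> $ idx0 * u $ idx0 + sharp \<beta> \<bullet> sharp G + c / 2 * (sharp \<beta> \<bullet> \<beta>)
      - potential (m0 * \<gamma>) \<beta> \<le> mean (\<lambda>v. \<eta> (g v))"
    by (simp only: gy_eq pot)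
  define a where "a = sharp G - sharp u"
  have square: "(norm (c *\<^sub>R x + a))\<^sup>2 = c\<^sup>2 * (norm x)\<^sup>2 + 2 * c * (x \<bullet> a) + (norm a)\<^sup>2" for x
    by (simp add: power2_norm_eq_inner inner_add_left inner_add_right inner_commute[of a x])
      (simp add: power2_eq_square algebra_simps)
  have "0 \<le> (norm (c *\<^sub>R sharp \<beta> + a))\<^sup>2 / (2 * c)"
    using \<open>0 < c\<close> by simp
  then have 2: "0 \<le> c / 2 * (sharp \<beta> \<bullet> \<beta>) + sharp \<beta> \<bullet> a + 1 / (2 * c) * (norm a)\<^sup>2"
    unfolding square sharp_inner_self
    using \<open>0 < c\<close> by (simp add: add_divide_distrib power2_eq_square)
  have "sharp \<beta> \<bullet> sharp G = sharp \<beta> \<bullet> a + sharp \<beta> \<bullet> u"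
    by (simp add: a_def inner_diff_right)
  then have 3: "\<beta> $ idx0 * u $ idx0 + sharp \<beta> \<bullet> sharp G = \<beta> \<bullet> u + sharp \<beta> \<bullet> a"
    by (simp add: inner_decomposition[of \<beta> u])
  have "mean (\<lambda>v. g v *\<^sub>R sharp (moments v :: real^'n::{finite, linorder})) = sharp G"
    unfolding G_def using mean_sharp[OF intm] by (simp add: sharp_scaleR)
  then have "objective \<gamma> u g = mean (\<lambda>v. \<eta> (g v)) + 1 / (2 * c) * (norm a)\<^sup>2"
    by (simp add: objective_def c_def a_def mult.assoc)
  with 1 2 3 show ?thesis
    by linarith
qed

text \<open>At \<open>u = \<nabla>P(\<beta>)\<close> both inequalities in the proof of weak duality become equalities. The zeroth
  entry of this equation is the moment constraint, \<open>u\<^sub>0 = m\<^sub>0 P(\<beta>)\<close>; the other entries say that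
  the moments of \<open>g\<close> miss \<open>sharp u\<close> by \<open>-u\<^sub>0 \<gamma> sharp \<beta>\<close>.\<close>

lemma exponential_density_optimal:
  fixes \<beta> :: "real^'n::{finite, linorder}" and \<gamma> :: real
  defines "g \<equiv> \<lambda>v. exp (\<beta> \<bullet> moments v + m0 * \<gamma> / 2 * (sharp \<beta> \<bullet> \<beta>))"
  assumes \<gamma>: "0 < \<gamma>"
  shows "g \<in> admissible (potential_grad (m0 * \<gamma>) \<beta>)"
    and "objective \<gamma> (potential_grad (m0 * \<gamma>) \<beta>) g
           = \<beta> \<bullet> potential_grad (m0 * \<gamma>) \<beta> - potential (m0 * \<gamma>) \<beta>"
proof -
  let ?P = "potential (m0 * \<gamma>) \<beta>"
  let ?q = "m0 * \<gamma> / 2 * (sharp \<beta> \<bullet> \<beta>)"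
  define u where "u = potential_grad (m0 * \<gamma>) \<beta>"
  define G where "G = mean (\<lambda>v. g v *\<^sub>R (moments v :: real^'n::{finite, linorder}))"
  define c where "c = u $ idx0 * \<gamma>"
  have contg: "continuous_on unit_sphere g"
    unfolding g_def by (intro continuous_intros)
  note int = integrable_continuous_on_sphere
  have intm: "integrable sphere_measure (\<lambda>v. g v *\<^sub>R (moments v :: real^'n::{finite, linorder}))"
    by (intro int continuous_intros contg)
  have \<eta>g: "\<eta> (g v) = \<beta> \<bullet> (g v *\<^sub>R moments v) + (?q - 1) * g v" for v
    by (simp add: \<eta>_def g_def algebra_simps)
  have meang: "mean g = ?P"
    using gauss_factor_exp_mean[of "m0 * \<gamma>" \<beta> "\<lambda>_. 1::real"] by (simp add: potential_def g_def)
  have uG: "u = G + (m0 * \<gamma> * ?P) *\<^sub>R sharp \<beta>"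
    using gauss_factor_exp_mean[of "m0 * \<gamma>" \<beta> moments]
    by (simp add: u_def potential_grad_def potential_def scaleR_add_right G_def g_def mult_ac)
  have "axis idx0 1 \<bullet> G = m0 * mean g"
    unfolding G_def by (subst integral_inner_right[symmetric], use intm in simp) (simp add: inner_axis' mult.commute)
  then have u0: "u $ idx0 = m0 * ?P"
    by (simp add: uG inner_axis' meang sharp_nth)
  have "0 < c"
    using m0_pos \<gamma> potential_pos[of "m0 * \<gamma>" \<beta>] by (simp add: c_def u0)
  have cP: "m0 * \<gamma> * ?P = c"
    by (simp add: c_def u0)
  show "g \<in> admissible (potential_grad (m0 * \<gamma>) \<beta>)"
    unfolding admissible_def u_def[symmetric]
  proof (intro CollectI conjI ballI)
    show "g \<in> borel_measurable sphere_measure"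
      using int[OF contg] by simp
    show "0 \<le> g v" for v
      by (simp add: g_def)
    show "integrable sphere_measure (\<lambda>v. \<eta> (g v))"
      unfolding \<eta>g by (intro int continuous_intros contg)
    show "mean (\<lambda>v. moments v $ (idx0 :: 'n) * g v) = u $ idx0"
      by (simp add: u0 meang)
  qed (rule intm)
  have "mean (\<lambda>v. g v *\<^sub>R sharp (moments v :: real^'n::{finite, linorder})) = sharp G"
    unfolding G_def using mean_sharp[OF intm] by (simp add: sharp_scaleR)
  then have "mean (\<lambda>v. g v *\<^sub>R sharp (moments v)) - sharp u = - c *\<^sub>R sharp \<beta>"
    by (simp add: uG sharp_add sharp_scaleR cP)
  then have "1 / (2 * c) * (norm (mean (\<lambda>v. g v *\<^sub>R sharp (moments v)) - sharp u))\<^sup>2 = c / 2 * (sharp \<beta> \<bullet> \<beta>)"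
    using \<open>0 < c\<close> by (simp add: sharp_inner_self power_mult_distrib power2_eq_square)
  moreover have "mean (\<lambda>v. \<eta> (g v)) = \<beta> \<bullet> G + (?q - 1) * mean g"
    unfolding \<eta>g G_def using intm int[OF contg]
    by (subst Bochner_Integration.integral_add) (simp_all del: inner_scaleR_right)
  moreover have "?q * mean g = c / 2 * (sharp \<beta> \<bullet> \<beta>)"
    by (simp add: meang flip: cP)
  moreover have "\<beta> \<bullet> u = \<beta> \<bullet> G + c * (sharp \<beta> \<bullet> \<beta>)"
    by (simp add: uG cP inner_add_right inner_commute[of \<beta> "sharp \<beta>"])
  moreover have "objective \<gamma> u g = mean (\<lambda>v. \<eta> (g v))
      + 1 / (2 * c) * (norm (mean (\<lambda>v. g v *\<^sub>R sharp (moments v)) - sharp u))\<^sup>2"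
    by (simp add: objective_def c_def mult.assoc)
  ultimately show "objective \<gamma> (potential_grad (m0 * \<gamma>) \<beta>) g
      = \<beta> \<bullet> potential_grad (m0 * \<gamma>) \<beta> - ?P"
    unfolding u_def[symmetric] left_diff_distrib meang by linarith
qed

lemma reg_entropy_potential_grad:
  assumes "0 < \<gamma>" "potential_grad (m0 * \<gamma>) \<beta> \<in> states"
  shows "reg_entropy \<gamma> (potential_grad (m0 * \<gamma>) \<beta>)
    = \<beta> \<bullet> potential_grad (m0 * \<gamma>) \<beta> - potential (m0 * \<gamma>) \<beta>"
  unfolding reg_entropy_def
proof (rule cInf_eq_minimum)
  show "\<beta> \<bullet> potential_grad (m0 * \<gamma>) \<beta> - potential (m0 * \<gamma>) \<beta>
      \<in> objective \<gamma> (potential_grad (m0 * \<gamma>) \<beta>) ` admissible (potential_grad (m0 * \<gamma>) \<beta>)"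
    by (rule image_eqI, rule exponential_density_optimal(2)[symmetric],
        rule assms, rule exponential_density_optimal(1), rule assms)
  show "\<beta> \<bullet> potential_grad (m0 * \<gamma>) \<beta> - potential (m0 * \<gamma>) \<beta> \<le> y"
    if "y \<in> objective \<gamma> (potential_grad (m0 * \<gamma>) \<beta>) ` admissible (potential_grad (m0 * \<gamma>) \<beta>)" for y
    using that weak_duality[OF assms] by auto
qed

section \<open>The entropy and its gradient\<close>

lemma open_states: "open states"
  unfolding states_def by (intro open_Collect_less continuous_intros)

lemma convex_states: "convex states"
  using convex_halfspace_gt[of 0 "axis idx0 (1 :: real)"] by (simp add: states_def inner_axis')

text \<open>Meaningful on the states, where the inverse is evaluated in the range of the gradient.\<close>

definition entropy_variable :: "real \<Rightarrow> real^'n::{finite, linorder} \<Rightarrow> real^'n::{finite, linorder}"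
  where "entropy_variable \<gamma> = inv (potential_grad (m0 * \<gamma>))"

lemma potential_grad_entropy_variable:
  assumes "0 < \<gamma>" "u \<in> states"
  shows "potential_grad (m0 * \<gamma>) (entropy_variable \<gamma> u) = u"
proof -
  have "0 < m0 * \<gamma>"
    using assms m0_pos by simp
  from potential_grad_surj_states[OF this assms(2)]
  have "u \<in> range (potential_grad (m0 * \<gamma>))"
    by (metis rangeI)
  then show ?thesis
    by (simp add: entropy_variable_def f_inv_into_f)
qed

text \<open>The derivative \<open>L\<close> is the inverse of the Hessian of the potential and inherits its symmetry and
  definiteness. It is the Hessian of the regularized entropy.\<close>

lemma entropy_variable_has_derivative:
  fixes u :: "real^'n::{finite, linorder}"
  assumes \<gamma>: "0 < \<gamma>" and u: "u \<in> states"
  obtains L where "(entropy_variable \<gamma> has_derivative L) (at u)"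
    "\<And>d e. d \<bullet> L e = e \<bullet> L d" "\<And>d. d \<noteq> 0 \<Longrightarrow> 0 < d \<bullet> L d"
proof -
  define \<kappa> where "\<kappa> = m0 * \<gamma>"
  define \<beta> where "\<beta> = entropy_variable \<gamma> u"
  have "0 < \<kappa>"
    using \<gamma> m0_pos by (simp add: \<kappa>_def)
  let ?H = "potential_hess \<kappa> \<beta>"
  have "linear ?H"
    using potential_grad_has_derivative by (rule has_derivative_linear)
  moreover have "inj ?H"
    unfolding linear_injective_0[OF \<open>linear ?H\<close>]
    using potential_hess_pos[OF \<open>0 < \<kappa>\<close>] by (metis inner_zero_right less_irrefl)
  ultimately obtain L where HL: "\<And>x. ?H (L x) = x"
    using linear_injective_isomorphism by blast
  have "continuous_on UNIV (potential_grad \<kappa> :: _ \<Rightarrow> real^'n::{finite, linorder})"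
    using has_derivative_continuous[OF potential_grad_has_derivative]
    by (blast intro: continuous_at_imp_continuous_on)
  moreover have "entropy_variable \<gamma> (potential_grad \<kappa> x) = x" for x
    unfolding entropy_variable_def \<kappa>_def[symmetric]
    by (rule inv_f_f[OF inj_potential_grad[OF \<open>0 < \<kappa>\<close>]])
  ultimately have "(entropy_variable \<gamma> has_derivative L) (at (potential_grad \<kappa> \<beta>))"
    using HL by (intro has_derivative_inverse_strong[where S = UNIV, OF _ _ _ _ potential_grad_has_derivative])
      (auto simp: fun_eq_iff)
  then have "(entropy_variable \<gamma> has_derivative L) (at u)"
    using potential_grad_entropy_variable[OF assms] by (simp add: \<beta>_def \<kappa>_def)
  moreover have "d \<bullet> L e = e \<bullet> L d" for d e
    using potential_hess_symmetric[of "L d" \<kappa> \<beta> "L e"] by (simp add: HL inner_commute)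
  moreover have "0 < d \<bullet> L d" if "d \<noteq> 0" for d
  proof -
    have "L d \<noteq> 0"
      using that HL[of d] linear_0[OF \<open>linear ?H\<close>] by auto
    from potential_hess_pos[OF \<open>0 < \<kappa>\<close> this, of \<beta>] show ?thesis
      by (simp add: HL inner_commute)
  qed
  ultimately show thesis
    using that by blast
qed

lemma reg_entropy_legendre:
  assumes "0 < \<gamma>" "u \<in> states"
  shows "reg_entropy \<gamma> u = entropy_variable \<gamma> u \<bullet> u - potential (m0 * \<gamma>) (entropy_variable \<gamma> u)"
  using reg_entropy_potential_grad[OF assms(1), of "entropy_variable \<gamma> u"] assms
  by (simp add: potential_grad_entropy_variable)

lemma reg_entropy_ge:
  assumes "0 < \<gamma>" "u \<in> states"
  shows "\<beta> \<bullet> u - potential (m0 * \<gamma>) \<beta> \<le> reg_entropy \<gamma> u"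
proof -
  let ?b = "entropy_variable \<gamma> u"
  note u = potential_grad_entropy_variable[OF assms]
  from exponential_density_optimal[OF assms(1), of ?b, unfolded u]
  obtain g where "g \<in> admissible u" "objective \<gamma> u g = ?b \<bullet> u - potential (m0 * \<gamma>) ?b"
    by blast
  then show ?thesis
    using weak_duality[OF assms, of g \<beta>] reg_entropy_legendre[OF assms] by simp
qed

text \<open>The entropy is the maximum over \<open>\<beta>\<close> of the affine functions \<open>\<beta> \<bullet> u - P(\<beta>)\<close>; at a convex
  combination the maximizer there is compared with the maximizers at the two end points.\<close>

lemma convex_on_reg_entropy:
  assumes "0 < \<gamma>"
  shows "convex_on states (reg_entropy \<gamma> :: real^'n::{finite, linorder} \<Rightarrow> real)"
proof (rule convex_onI)
  fix t :: real and x y :: "real^'n::{finite, linorder}"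
  assume t: "0 < t" "t < 1" and x: "x \<in> states" and y: "y \<in> states"
  let ?z = "(1 - t) *\<^sub>R x + t *\<^sub>R y"
  have z: "?z \<in> states"
    using convexD_alt[OF convex_states x y] t by simp
  let ?b = "entropy_variable \<gamma> ?z"
  let ?P = "potential (m0 * \<gamma>) ?b"
  have "reg_entropy \<gamma> ?z = (1 - t) * (?b \<bullet> x - ?P) + t * (?b \<bullet> y - ?P)"
    unfolding reg_entropy_legendre[OF assms z] by (simp add: inner_add_right algebra_simps)
  also have "\<dots> \<le> (1 - t) * reg_entropy \<gamma> x + t * reg_entropy \<gamma> y"
    using t by (intro add_mono mult_left_mono reg_entropy_ge assms x y) auto
  finally show "reg_entropy \<gamma> ?z \<le> (1 - t) * reg_entropy \<gamma> x + t * reg_entropy \<gamma> y" .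
qed (rule convex_states)

text \<open>The envelope argument: the variation of \<open>\<beta>(u)\<close> drops out because \<open>\<nabla>P(\<beta>(u)) = u\<close>.\<close>

lemma reg_entropy_has_derivative:
  assumes "0 < \<gamma>" "u \<in> states"
  shows "(reg_entropy \<gamma> has_derivative (\<lambda>d. entropy_variable \<gamma> u \<bullet> d)) (at u)"
proof -
  obtain L where L: "(entropy_variable \<gamma> has_derivative L) (at u)"
    by (rule entropy_variable_has_derivative[OF assms]) (rule that)
  have "((\<lambda>u. entropy_variable \<gamma> u \<bullet> u - potential (m0 * \<gamma>) (entropy_variable \<gamma> u)) has_derivative
      (\<lambda>d. entropy_variable \<gamma> u \<bullet> d + L d \<bullet> u - L d \<bullet> potential_grad (m0 * \<gamma>) (entropy_variable \<gamma> u))) (at u)"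
    by (intro has_derivative_diff has_derivative_inner L has_derivative_ident
        has_derivative_compose[OF L potential_has_derivative])
  then have "((\<lambda>u. entropy_variable \<gamma> u \<bullet> u - potential (m0 * \<gamma>) (entropy_variable \<gamma> u)) has_derivative
      (\<lambda>d. entropy_variable \<gamma> u \<bullet> d)) (at u)"
    by (simp add: potential_grad_entropy_variable[OF assms])
  then show ?thesis
    by (rule has_derivative_transform_within_open[OF _ open_states assms(2)])
      (simp add: reg_entropy_legendre[OF assms(1)])
qed

lemma grad_reg_entropy:
  "0 < \<gamma> \<Longrightarrow> u \<in> states \<Longrightarrow> grad (reg_entropy \<gamma>) u = entropy_variable \<gamma> u"
  by (intro grad_eqI reg_entropy_has_derivative)

section \<open>Fluxes in terms of the entropy variable\<close>

text \<open>The flux of the density \<open>exp (\<beta> \<bullet> m)\<close> as a function of \<open>\<beta>\<close>, written \<open>\<Phi>\<^sub>i\<close> in the comments.\<close>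

definition dual_flux :: "3 \<Rightarrow> real^'n::{finite, linorder} \<Rightarrow> real^'n::{finite, linorder}"
  where "dual_flux i = exp_mean (\<lambda>v. (v $ i) *\<^sub>R moments v)"

definition dual_flux_deriv :: "3 \<Rightarrow> real^'n::{finite, linorder} \<Rightarrow> real^'n::{finite, linorder} \<Rightarrow> real^'n::{finite, linorder}"
  where "dual_flux_deriv i \<beta> d = exp_mean (\<lambda>v. (d \<bullet> moments v) *\<^sub>R (v $ i) *\<^sub>R moments v) \<beta>"

lemma dual_flux_has_derivative: "(dual_flux i has_derivative dual_flux_deriv i \<beta>) (at \<beta>)"
  unfolding dual_flux_def dual_flux_deriv_def[abs_def]
  by (intro exp_mean_has_derivative continuous_intros)

text \<open>Both sides are the exponentially weighted mean of \<open>v\<^sub>i (d \<bullet> m) (e \<bullet> m)\<close>. This symmetry is what makes the system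
  symmetrizable.\<close>

lemma dual_flux_deriv_symmetric: "e \<bullet> dual_flux_deriv i \<beta> d = d \<bullet> dual_flux_deriv i \<beta> e"
proof -
  have "e \<bullet> dual_flux_deriv i \<beta> d = exp_mean (\<lambda>v. e \<bullet> ((d \<bullet> moments v) *\<^sub>R (v $ i) *\<^sub>R moments v)) \<beta>" for e d
    unfolding dual_flux_deriv_def by (intro inner_exp_mean continuous_intros)
  then show ?thesis
    by (simp add: mult_ac)
qed

lemma moment_flux_eq:
  "0 < \<gamma> \<Longrightarrow> u \<in> states \<Longrightarrow> moment_flux \<gamma> i u = dual_flux i (entropy_variable \<gamma> u)"
  by (simp add: moment_flux_def dual_flux_def exp_mean_def ansatz_def grad_reg_entropy mult.commute)

text \<open>This is \<open>\<eta> (exp y) = y exp y - exp y\<close> under the integral.\<close>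

lemma entropy_flux_eq:
  assumes "0 < \<gamma>" "u \<in> states"
  shows "entropy_flux \<gamma> i u = entropy_variable \<gamma> u \<bullet> dual_flux i (entropy_variable \<gamma> u)
    - exp_mean (\<lambda>v. v $ i) (entropy_variable \<gamma> u)"
proof -
  let ?b = "entropy_variable \<gamma> u"
  have "?b \<bullet> dual_flux i ?b = exp_mean (\<lambda>v. ?b \<bullet> ((v $ i) *\<^sub>R moments v)) ?b"
    unfolding dual_flux_def by (intro inner_exp_mean continuous_intros)
  moreover have "integrable sphere_measure (\<lambda>v. exp (?b \<bullet> moments v) *\<^sub>R (?b \<bullet> ((v $ i) *\<^sub>R moments v)))"
    "integrable sphere_measure (\<lambda>v. exp (?b \<bullet> moments v) *\<^sub>R (v $ i))"
    by (intro integrable_continuous_on_sphere continuous_intros)+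
  moreover have "v $ i * \<eta> (exp (?b \<bullet> moments v)) = exp (?b \<bullet> moments v) *\<^sub>R (?b \<bullet> ((v $ i) *\<^sub>R moments v))
      - exp (?b \<bullet> moments v) *\<^sub>R (v $ i)" for v
    by (simp add: \<eta>_def algebra_simps)
  ultimately show ?thesis
    by (simp only: entropy_flux_def ansatz_def grad_reg_entropy[OF assms] exp_mean_def
        Bochner_Integration.integral_diff)
qed

lemma moment_flux_has_derivative:
  assumes "0 < \<gamma>" "u \<in> states" and L: "(entropy_variable \<gamma> has_derivative L) (at u)"
  shows "(moment_flux \<gamma> i has_derivative (\<lambda>d. dual_flux_deriv i (entropy_variable \<gamma> u) (L d))) (at u)"
  by (rule has_derivative_transform_within_open[OF
        has_derivative_compose[OF L dual_flux_has_derivative] open_states assms(2)])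
    (simp add: moment_flux_eq assms(1))

text \<open>In \<open>\<beta> \<bullet> \<Phi>\<^sub>i(\<beta>) - \<langle>v\<^sub>i exp (\<beta> \<bullet> m)\<rangle>\<close> the derivative of the second term is \<open>d \<bullet> \<Phi>\<^sub>i(\<beta>)\<close> and
  cancels the part of the product rule where \<open>\<beta>\<close> itself is differentiated.\<close>

lemma entropy_flux_has_derivative:
  assumes "0 < \<gamma>" "u \<in> states" and L: "(entropy_variable \<gamma> has_derivative L) (at u)"
  shows "(entropy_flux \<gamma> i has_derivative
      (\<lambda>d. entropy_variable \<gamma> u \<bullet> dual_flux_deriv i (entropy_variable \<gamma> u) (L d))) (at u)"
proof -
  let ?b = "entropy_variable \<gamma> u"
  have "((\<lambda>\<beta>. \<beta> \<bullet> dual_flux i \<beta> - exp_mean (\<lambda>v. v $ i) \<beta>) has_derivative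
      (\<lambda>d. ?b \<bullet> dual_flux_deriv i ?b d + d \<bullet> dual_flux i ?b - exp_mean (\<lambda>v. (d \<bullet> moments v) *\<^sub>R v $ i) ?b)) (at ?b)"
    by (intro has_derivative_diff has_derivative_inner has_derivative_ident dual_flux_has_derivative
        exp_mean_has_derivative continuous_intros)
  moreover have "d \<bullet> dual_flux i ?b = exp_mean (\<lambda>v. (d \<bullet> moments v) *\<^sub>R v $ i) ?b" for d
  proof -
    have "d \<bullet> dual_flux i ?b = exp_mean (\<lambda>v. d \<bullet> ((v $ i) *\<^sub>R moments v)) ?b"
      unfolding dual_flux_def by (intro inner_exp_mean continuous_intros)
    then show ?thesis
      by (simp add: mult.commute)
  qed
  ultimately have "((\<lambda>\<beta>. \<beta> \<bullet> dual_flux i \<beta> - exp_mean (\<lambda>v. v $ i) \<beta>) has_derivative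
      (\<lambda>d. ?b \<bullet> dual_flux_deriv i ?b d)) (at ?b)"
    by simp
  from has_derivative_compose[OF L this] show ?thesis
    by (rule has_derivative_transform_within_open[OF _ open_states assms(2)])
      (simp add: entropy_flux_eq assms(1))
qed

section \<open>Dissipation by collisions\<close>

text \<open>Choose the constant \<open>c\<close> such that \<open>exp y - exp c\<close> has mean zero. By monotonicity of the
  exponential \<open>(exp y - exp c) (y - c) \<ge> 0\<close>, and after integration the part with the factor
  \<open>c\<close> vanishes.\<close>

lemma collision_dissipation:
  assumes y: "continuous_on unit_sphere y" and "0 \<le> s"
  shows "mean (\<lambda>v. collision s (\<lambda>w. exp (y w)) v * y v) \<le> 0"
proof -
  define A where "A = measure sphere_measure unit_sphere"
  define F where "F = mean (\<lambda>v. exp (y v))"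
  define c where "c = ln (F / A)"
  note int = integrable_continuous_on_sphere
  have "0 < A"
    using measure_sphere_measure_pos by (simp add: A_def)
  have "0 < F"
    unfolding F_def by (intro mean_pos continuous_intros y) simp
  have [simp]: "integrable sphere_measure y" "integrable sphere_measure (\<lambda>v. exp (y v))"
    "integrable sphere_measure (\<lambda>v. exp (y v) * y v)"
    by (intro int continuous_intros y)+
  have exp_c: "exp c = F / A"
    using \<open>0 < F\<close> \<open>0 < A\<close> by (simp add: c_def)
  have "0 \<le> (exp z - exp c) * (z - c)" for z
    by (cases "c \<le> z") (auto intro: mult_nonpos_nonpos)
  then have "0 \<le> mean (\<lambda>v. (exp (y v) - exp c) * (y v - c))"
    by (intro Bochner_Integration.integral_nonneg)
  also have "(\<lambda>v. (exp (y v) - exp c) * (y v - c))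
      = (\<lambda>v. exp (y v) * y v - c * exp (y v) - exp c * y v + exp c * c)"
    by (simp add: algebra_simps)
  also have "mean \<dots> = mean (\<lambda>v. exp (y v) * y v) - c * F - exp c * mean y + A * (exp c * c)"
    by (simp add: F_def A_def)
  also have "\<dots> = mean (\<lambda>v. exp (y v) * y v) - F / A * mean y"
    using \<open>0 < A\<close> by (simp add: exp_c)
  finally have "F * mean y \<le> A * mean (\<lambda>v. exp (y v) * y v)"
    using \<open>0 < A\<close> by (simp add: field_simps)
  moreover have "collision s (\<lambda>w. exp (y w)) v = s * (F - A * exp (y v))" for v
    by (simp add: collision_def F_def A_def)
  then have "collision s (\<lambda>w. exp (y w)) v * y v = s * (F * y v - A * (exp (y v) * y v))" for v
    by (simp only:) (simp add: algebra_simps)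
  then have "mean (\<lambda>v. collision s (\<lambda>w. exp (y w)) v * y v)
      = s * (F * mean y - A * mean (\<lambda>v. exp (y v) * y v))"
    by simp
  ultimately show ?thesis
    using \<open>0 \<le> s\<close> by (simp add: mult_nonneg_nonpos)
qed

lemma grad_inner_moment_source:
  fixes u :: "real^'n::{finite, linorder}"
  assumes "0 \<le> \<sigma> x"
  shows "grad (reg_entropy \<gamma>) u \<bullet> moment_source \<gamma> \<sigma> x u \<le> 0"
proof -
  let ?b = "grad (reg_entropy \<gamma>) u"
  let ?Q = "collision (\<sigma> x) (ansatz \<gamma> u)"
  have cont: "continuous_on unit_sphere (ansatz \<gamma> u)"
    unfolding ansatz_def[abs_def] by (intro continuous_intros)
  have "?Q v = \<sigma> x * (mean (ansatz \<gamma> u) - measure sphere_measure unit_sphere * ansatz \<gamma> u v)" for v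
    using integrable_continuous_on_sphere[OF cont] by (simp add: collision_def)
  then have "continuous_on unit_sphere ?Q"
    using cont by (simp add: continuous_intros)
  then have "integrable sphere_measure (\<lambda>v. ?Q v *\<^sub>R (moments v :: real^'n::{finite, linorder}))"
    by (intro integrable_continuous_on_sphere continuous_intros)
  then have "?b \<bullet> moment_source \<gamma> \<sigma> x u = mean (\<lambda>v. ?Q v * (?b \<bullet> moments v))"
    unfolding moment_source_def by (subst integral_inner_right[symmetric]) simp_all
  also have "\<dots> \<le> 0"
    unfolding ansatz_def[abs_def] by (intro collision_dissipation continuous_intros assms)
  finally show ?thesis .
qed

section \<open>Entropy pair and symmetrizability\<close>

lemma entropy_pair_reg_entropy:
  fixes \<gamma> :: real
  assumes \<gamma>: "0 < \<gamma>" and \<sigma>: "\<And>x. 0 \<le> \<sigma> x"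
  shows "entropy_pair states (moment_flux \<gamma>) (moment_source \<gamma> \<sigma>)
    (reg_entropy \<gamma> :: real^'n::{finite, linorder} \<Rightarrow> real) (entropy_flux \<gamma>)"
  unfolding entropy_pair_def
proof (intro conjI ballI allI)
  fix u :: "real^'n::{finite, linorder}" and i
  assume u: "u \<in> states"
  obtain L where L: "(entropy_variable \<gamma> has_derivative L) (at u)"
    by (rule entropy_variable_has_derivative[OF \<gamma> u]) (rule that)
  let ?b = "entropy_variable \<gamma> u"
  note F = moment_flux_has_derivative[OF \<gamma> u L, of i]
  note j = entropy_flux_has_derivative[OF \<gamma> u L, of i]
  show "reg_entropy \<gamma> differentiable (at u)" "moment_flux \<gamma> i differentiable (at u)"
    "entropy_flux \<gamma> i differentiable (at u)"
    using reg_entropy_has_derivative[OF \<gamma> u] F j unfolding differentiable_def by blast+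
  have "(transpose (jacobian (moment_flux \<gamma> i) (at u)) *v ?b) \<bullet> d = ?b \<bullet> dual_flux_deriv i ?b (L d)" for d
    by (simp only: inner_transpose_matrix_vector jacobian_vector[OF F])
  with j show "grad (entropy_flux \<gamma> i) u
      = transpose (jacobian (moment_flux \<gamma> i) (at u)) *v grad (reg_entropy \<gamma>) u"
    unfolding grad_reg_entropy[OF \<gamma> u] by (intro grad_eqI) simp
  show "grad (reg_entropy \<gamma>) u \<bullet> moment_source \<gamma> \<sigma> x u \<le> 0" for x
    by (rule grad_inner_moment_source[where \<sigma> = \<sigma>, OF \<sigma>])
qed (rule convex_on_reg_entropy[OF \<gamma>])

text \<open>The symmetrizer is the Hessian \<open>K\<close> of the entropy. The Jacobian of the flux is \<open>S\<^sub>i K\<close> with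
  \<open>S\<^sub>i\<close> symmetric, so \<open>K S\<^sub>i K\<close> is symmetric.\<close>

lemma symmetrizable_hyperbolic_moment_flux:
  assumes \<gamma>: "0 < \<gamma>"
  shows "symmetrizable_hyperbolic (states :: (real^'n::{finite, linorder}) set) (moment_flux \<gamma>)"
  unfolding symmetrizable_hyperbolic_def
proof (intro conjI ballI allI exI[where x = "\<lambda>u. jacobian (entropy_variable \<gamma>) (at u)"] impI)
  fix u :: "real^'n::{finite, linorder}"
  assume u: "u \<in> states"
  obtain L where L: "(entropy_variable \<gamma> has_derivative L) (at u)"
    and sym: "\<And>d e. d \<bullet> L e = e \<bullet> L d" and pos: "\<And>d. d \<noteq> 0 \<Longrightarrow> 0 < d \<bullet> L d"
    by (rule entropy_variable_has_derivative[OF \<gamma> u]) (rule that)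
  have K: "jacobian (entropy_variable \<gamma>) (at u) *v d = L d" for d
    by (rule jacobian_vector[OF L])
  show "transpose (jacobian (entropy_variable \<gamma>) (at u)) = jacobian (entropy_variable \<gamma>) (at u)"
    using sym by (simp add: transpose_eq_self_iff K)
  show "0 < w \<bullet> (jacobian (entropy_variable \<gamma>) (at u) *v w)" if "w \<noteq> 0" for w
    using pos[OF that] by (simp add: K)
  fix i
  note F = moment_flux_has_derivative[OF \<gamma> u L, of i]
  show "moment_flux \<gamma> i differentiable (at u)"
    using F unfolding differentiable_def by blast
  let ?S = "dual_flux_deriv i (entropy_variable \<gamma> u)"
  have J: "jacobian (moment_flux \<gamma> i) (at u) *v d = ?S (L d)" for d
    by (rule jacobian_vector[OF F])
  have "x \<bullet> L (?S (L y)) = y \<bullet> L (?S (L x))" for x y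
    by (metis sym dual_flux_deriv_symmetric inner_commute)
  then show "transpose (jacobian (entropy_variable \<gamma>) (at u) ** jacobian (moment_flux \<gamma> i) (at u))
      = jacobian (entropy_variable \<gamma>) (at u) ** jacobian (moment_flux \<gamma> i) (at u)"
    by (simp add: transpose_eq_self_iff K J flip: matrix_vector_mul_assoc)
qed

theorem theorem5:
  fixes N :: nat and \<gamma> :: real and \<sigma> :: "real^3 \<Rightarrow> real"
  assumes "1 \<le> N"
    and "CARD('n::{finite, linorder}) = (N + 1)\<^sup>2"
    and "0 < \<gamma>"
    and "\<And>x. 0 \<le> \<sigma> x"
  shows "entropy_pair states (moment_flux \<gamma>) (moment_source \<gamma> \<sigma>)
           (reg_entropy \<gamma> :: real^'n::{finite, linorder} \<Rightarrow> real) (entropy_flux \<gamma>) \<and>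
         (\<forall>D (u :: real \<times> (real^3) \<Rightarrow> real^'n::{finite, linorder}).
           classical_solution states (moment_flux \<gamma>) (moment_source \<gamma> \<sigma>) D u \<longrightarrow>
           entropy_dissipation (reg_entropy \<gamma>) (entropy_flux \<gamma>) D u) \<and>
         symmetrizable_hyperbolic (states :: (real^'n::{finite, linorder}) set) (moment_flux \<gamma>)"
proof (intro conjI allI impI)
  show pair: "entropy_pair states (moment_flux \<gamma>) (moment_source \<gamma> \<sigma>)
      (reg_entropy \<gamma> :: real^'n::{finite, linorder} \<Rightarrow> real) (entropy_flux \<gamma>)"
    using assms(3,4) by (rule entropy_pair_reg_entropy)
  show "entropy_dissipation (reg_entropy \<gamma>) (entropy_flux \<gamma>) D u"
    if "classical_solution states (moment_flux \<gamma>) (moment_source \<gamma> \<sigma>) D u"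
    for D and u :: "real \<times> (real^3) \<Rightarrow> real^'n::{finite, linorder}"
    using pair that by (rule entropy_pair_dissipation)
  show "symmetrizable_hyperbolic (states :: (real^'n::{finite, linorder}) set) (moment_flux \<gamma>)"
    using assms(3) by (rule symmetrizable_hyperbolic_moment_flux)
qed

end
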